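(* Suppose the interferers are the points in the disk $\mathcal A$ (radius $r_{\mathsf{out}}$, center $0$) of a homogeneous Poisson point process of intensity $\lambda>0$ on $\mathbb R^2$, so that their number $M$ is Poisson with mean $\lambda|\mathcal A|$, and let $p_i=p\in[0,1]$ for all $i$. Then, for each $i\in\{1,2\}$, $$\mathbb E_{M,\boldsymbol r}[\epsilon_i(\boldsymbol r)]=1-\exp\left\{-\frac{\beta}{\mathsf{SNR}}-2\lambda p\left[\frac{|\mathcal A|}{2}-\frac{\pi r_0^2}{\beta}\Psi\left(\frac{r_{\mathsf{out}}-r_0}{r_0}\right)-r_0^2\,\mathcal Z_1(r_{\mathsf{out}},r_0)\right]\right\},$$ $$\mathbb E_{M,\boldsymbol r}[\epsilon_i^2(\boldsymbol r)]=2\,\mathbb E_{M,\boldsymbol r}[\epsilon_i(\boldsymbol r)]-1+\exp\left\{-\frac{2\beta}{\mathsf{SNR}}-\lambda|\mathcal A|\left[1-\mathcal S(r_{\mathsf{out}},r_0)\right]\right\},$$ $$\mathbb E_{M,\boldsymbol r}[\epsilon_1(\boldsymbol r)\,\epsilon_2(\boldsymbol r)]=2\,\mathbb E_{M,\boldsymbol r}[\epsilon_i(\boldsymbol r)]-1+\exp\left\{-\frac{2\beta}{\mathsf{SNR}}-\lambda|\mathcal A|\left[1-\mathcal W(r_{\mathsf{out}},r_0,\theta)\right]\right\},$$ where $\Psi,\mathcal Z_1,\mathcal S,\mathcal W$ are the functions defined in the context.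
   Context: Network model. Identify the plane with $\mathbb C$. The network region $\mathcal A$ is the disk of radius $r_{\mathsf{out}}$ centered at $0$, with area $|\mathcal A|=\pi r_{\mathsf{out}}^2$. A reference transmitter is at $X_0=0$; two receivers are at $Y_1=r_0$ and $Y_2=r_0e^{\mathrm{i}\theta}$, where $0<r_0\le r_{\mathsf{out}}$, $\theta\in\mathbb R$. There are $M$ interferers at positions $X_1,\dots,X_M\in\mathcal A$. Put $r_{i,j}=|X_i-Y_j|/r_0$ and $\boldsymbol r=\{r_{i,j}\}_{1\le i\le M,\,j\in\{1,2\}}$. Constants: path-loss exponent $\alpha>0$, SINR threshold $\beta>0$, $\mathsf{SNR}>0$. The SINR at $Y_j$ is $$\gamma_j=\frac{g_{0,j}}{\mathsf{SNR}^{-1}+\sum_{i=1}^M I_i\,g_{i,j}\,r_{i,j}^{-\alpha}},$$ where the $g_{i,j}$ are i.i.d. unit-mean exponential random variables (Rayleigh fading), the $I_i$ are independent Bernoulli variables with $\mathbb P[I_i=1]=p_i$, and the $g$'s, the $I$'s and the point process are mutually independent. The conditional outage probability is $$\epsilon_j(\boldsymbol r)=\mathbb P[\gamma_j\le\beta\mid\boldsymbol r,M]=1-\exp\left(-\frac{\beta}{\mathsf{SNR}}\right)\prod_{i=1}^M\left(1-p_i+\frac{p_i\,r_{i,j}^\alpha}{\beta+r_{i,j}^\alpha}\right).$$ $\mathbb E_{M,\boldsymbol r}$ denotes expectation over both the number and the positions of the interferers. Functions: $$\Psi(x)=\int_0^x\frac{r^{\alpha+1}}{1+r^\alpha\beta^{-1}}\,dr,\qquad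 \mathcal G(x)=\int_0^x\frac{r^{2\alpha+1}}{(\beta+r^\alpha)^2}\,dr,$$ $$\mathcal Z_k(x,y)=\int_{(x-y)/y}^{(x+y)/y}\frac{r^{k\alpha+1}}{(\beta+r^\alpha)^k}\arccos\left(\frac{y^2r^2+y^2-x^2}{2y^2r}\right)dr\quad(k=1,2),$$ $$\mathcal S(r_{\mathsf{out}},r_0)=(1-p)^2+\frac{4r_0^2}{|\mathcal A|}(1-p)p\left[\frac{\pi}{\beta}\Psi\left(\frac{r_{\mathsf{out}}-r_0}{r_0}\right)+\mathcal Z_1(r_{\mathsf{out}},r_0)\right]+\frac{2r_0^2p^2}{|\mathcal A|}\left[\pi\,\mathcal G\left(\frac{r_{\mathsf{out}}-r_0}{r_0}\right)+\mathcal Z_2(r_{\mathsf{out}},r_0)\right],$$ $$\mathcal W(r_{\mathsf{out}},r_0,\theta)=(1-p)^2+p^2\mathcal X(\theta)+\frac{4r_0^2}{|\mathcal A|}(1-p)p\left[\frac{\pi}{\beta}\Psi\left(\frac{r_{\mathsf{out}}-r_0}{r_0}\right)+\mathcal Z_1(r_{\mathsf{out}},r_0)\right],$$ $$\mathcal X(\theta)=\frac1{2\pi}\int_0^1\int_0^{2\pi}\frac{r^\alpha(\rho,\phi,0)}{\beta+r^\alpha(\rho,\phi,0)}\cdot\frac{r^\alpha(\rho,\phi,\theta)}{\beta+r^\alpha(\rho,\phi,\theta)}\,d\phi\,d\rho,\qquad r(\rho,\phi,\theta)=\frac{\left|r_0e^{\mathrm{i}\theta}+r_{\mathsf{out}}\sqrt{\rho}\,e^{\mathrm{i}\phi}\right|}{r_0}.$$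 *)

theory Defs
  imports "HOL-Probability.Probability"
begin

section \<open>Homogeneous Poisson point processes in the plane\<close>

text \<open>
  A point process is modelled as a random locally finite subset of the plane; this loses nothing,
  since homogeneous Poisson processes are simple. The count of a region of area 0 is almost surely
  0, in accordance with \<open>0 ^ 0 = 1\<close>. Independence of the counts for infinite disjoint families is
  the same as for finite ones (independence only concerns finite subfamilies, and a finite family
  can be padded with empty sets).
\<close>

definition homogeneous_poisson_process ::
    "'w measure \<Rightarrow> real \<Rightarrow> ('w \<Rightarrow> complex set) \<Rightarrow> bool" where
  "homogeneous_poisson_process \<Omega> rate \<Phi> \<longleftrightarrow>
     (\<forall>\<omega>\<in>space \<Omega>. \<forall>B. bounded B \<longrightarrow> finite (\<Phi> \<omega> \<inter> B)) \<and>
     (\<forall>B\<in>sets borel. bounded B \<longrightarrow>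
        (\<lambda>\<omega>. card (\<Phi> \<omega> \<inter> B)) \<in> measurable \<Omega> (count_space UNIV) \<and>
        (\<forall>n. measure \<Omega> {\<omega> \<in> space \<Omega>. card (\<Phi> \<omega> \<inter> B) = n} =
               exp (- (rate * measure lborel B)) * (rate * measure lborel B) ^ n / fact n)) \<and>
     (\<forall>B :: nat \<Rightarrow> complex set.
        disjoint_family B \<and> (\<forall>k. B k \<in> sets borel \<and> bounded (B k)) \<longrightarrow>
        prob_space.indep_vars \<Omega> (\<lambda>_. count_space UNIV) (\<lambda>k \<omega>. card (\<Phi> \<omega> \<inter> B k)) UNIV)"


section \<open>Network geometry\<close>

definition network_region :: "real \<Rightarrow> complex set" where
  "network_region rout = cball 0 rout"

definition region_area :: "real \<Rightarrow> real" where
  "region_area rout = pi * rout\<^sup>2"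

definition receiver :: "real \<Rightarrow> real \<Rightarrow> nat \<Rightarrow> complex" where
  "receiver r0 \<theta> j = (if j = 1 then of_real r0 else of_real r0 * cis \<theta>)"

definition rel_dist ::
    "real \<Rightarrow> real \<Rightarrow> (nat \<Rightarrow> 'w \<Rightarrow> complex) \<Rightarrow> nat \<Rightarrow> nat \<Rightarrow> 'w \<Rightarrow> real" where
  "rel_dist r0 \<theta> X i j \<omega> = cmod (X i \<omega> - receiver r0 \<theta> j) / r0"

text \<open>
  The interferers are \<open>X 1 \<omega>, \<dots>, X (M \<omega>) \<omega>\<close>; the variables \<open>X i \<omega>\<close> with \<open>i > M \<omega>\<close> are
  meaningless. The two records below package the finite data (number, positions) and (number,
  relative distances) as random elements of a fixed measurable space, with meaningless entries
  overwritten by 0.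
\<close>

definition positions ::
    "('w \<Rightarrow> nat) \<Rightarrow> (nat \<Rightarrow> 'w \<Rightarrow> complex) \<Rightarrow> 'w \<Rightarrow> nat \<times> (nat \<Rightarrow> complex)" where
  "positions M X \<omega> = (M \<omega>, \<lambda>i. if i \<in> {1..M \<omega>} then X i \<omega> else 0)"

definition distances ::
    "real \<Rightarrow> real \<Rightarrow> ('w \<Rightarrow> nat) \<Rightarrow> (nat \<Rightarrow> 'w \<Rightarrow> complex) \<Rightarrow> 'w \<Rightarrow> nat \<times> (nat \<times> nat \<Rightarrow> real)" where
  "distances r0 \<theta> M X \<omega> =
     (M \<omega>, \<lambda>(i, j)\<in>UNIV \<times> {1, 2}. if i \<in> {1..M \<omega>} then rel_dist r0 \<theta> X i j \<omega> else 0)"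


section \<open>Sigma-algebras generated by the random data\<close>

definition sigma_positions ::
    "'w measure \<Rightarrow> ('w \<Rightarrow> nat) \<Rightarrow> (nat \<Rightarrow> 'w \<Rightarrow> complex) \<Rightarrow> 'w measure" where
  "sigma_positions \<Omega> M X =
     vimage_algebra (space \<Omega>) (positions M X) (count_space UNIV \<Otimes>\<^sub>M PiM UNIV (\<lambda>_. borel))"

definition sigma_distances ::
    "'w measure \<Rightarrow> real \<Rightarrow> real \<Rightarrow> ('w \<Rightarrow> nat) \<Rightarrow> (nat \<Rightarrow> 'w \<Rightarrow> complex) \<Rightarrow> 'w measure" where
  "sigma_distances \<Omega> r0 \<theta> M X =
     vimage_algebra (space \<Omega>) (distances r0 \<theta> M X)
       (count_space UNIV \<Otimes>\<^sub>M PiM (UNIV \<times> {1, 2}) (\<lambda>_. borel))"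

definition sigma_gains :: "'w measure \<Rightarrow> (nat \<Rightarrow> nat \<Rightarrow> 'w \<Rightarrow> real) \<Rightarrow> 'w measure" where
  "sigma_gains \<Omega> g =
     vimage_algebra (space \<Omega>) (\<lambda>\<omega>. \<lambda>(i, j)\<in>UNIV \<times> {1, 2}. g i j \<omega>)
       (PiM (UNIV \<times> {1, 2}) (\<lambda>_. borel))"

definition sigma_activities :: "'w measure \<Rightarrow> (nat \<Rightarrow> 'w \<Rightarrow> bool) \<Rightarrow> 'w measure" where
  "sigma_activities \<Omega> I =
     vimage_algebra (space \<Omega>) (\<lambda>\<omega>. \<lambda>i\<in>{1..}. I i \<omega>) (PiM {1..} (\<lambda>_. count_space UNIV))"


section \<open>SINR and conditional outage probability\<close>

text \<open>
  If an interferer sits exactly on a receiver, \<open>0 powr (- \<alpha>) = 0\<close> replaces the value \<open>\<infinity>\<close>; for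
  interferers from a Poisson process this is an event of probability 0.
\<close>

definition sinr ::
    "real \<Rightarrow> real \<Rightarrow> real \<Rightarrow> real \<Rightarrow> ('w \<Rightarrow> nat) \<Rightarrow> (nat \<Rightarrow> 'w \<Rightarrow> complex) \<Rightarrow>
     (nat \<Rightarrow> 'w \<Rightarrow> bool) \<Rightarrow> (nat \<Rightarrow> nat \<Rightarrow> 'w \<Rightarrow> real) \<Rightarrow> nat \<Rightarrow> 'w \<Rightarrow> real" where
  "sinr \<alpha> SNR r0 \<theta> M X I g j \<omega> =
     g 0 j \<omega> / (inverse SNR +
       (\<Sum>i=1..M \<omega>. of_bool (I i \<omega>) * g i j \<omega> * rel_dist r0 \<theta> X i j \<omega> powr (- \<alpha>)))"

definition outage_prob ::
    "'w measure \<Rightarrow> real \<Rightarrow> real \<Rightarrow> real \<Rightarrow> real \<Rightarrow> real \<Rightarrow> ('w \<Rightarrow> nat) \<Rightarrow> (nat \<Rightarrow> 'w \<Rightarrow> complex) \<Rightarrow>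
     (nat \<Rightarrow> 'w \<Rightarrow> bool) \<Rightarrow> (nat \<Rightarrow> nat \<Rightarrow> 'w \<Rightarrow> real) \<Rightarrow> nat \<Rightarrow> 'w \<Rightarrow> real" where
  "outage_prob \<Omega> \<alpha> \<beta> SNR r0 \<theta> M X I g j =
     real_cond_exp \<Omega> (sigma_distances \<Omega> r0 \<theta> M X)
       (indicator {\<omega> \<in> space \<Omega>. sinr \<alpha> SNR r0 \<theta> M X I g j \<omega> \<le> \<beta>})"


section \<open>Auxiliary functions of the closed forms\<close>

definition Psi :: "real \<Rightarrow> real \<Rightarrow> real \<Rightarrow> real" where
  "Psi \<alpha> \<beta> x = integral {0..x} (\<lambda>r. r powr (\<alpha> + 1) / (1 + r powr \<alpha> * inverse \<beta>))"

definition calG :: "real \<Rightarrow> real \<Rightarrow> real \<Rightarrow> real" where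
  "calG \<alpha> \<beta> x = integral {0..x} (\<lambda>r. r powr (2 * \<alpha> + 1) / (\<beta> + r powr \<alpha>)\<^sup>2)"

definition calZ :: "real \<Rightarrow> real \<Rightarrow> nat \<Rightarrow> real \<Rightarrow> real \<Rightarrow> real" where
  "calZ \<alpha> \<beta> k x y =
     integral {(x - y) / y..(x + y) / y}
       (\<lambda>r. r powr (real k * \<alpha> + 1) / (\<beta> + r powr \<alpha>) ^ k *
             arccos ((y\<^sup>2 * r\<^sup>2 + y\<^sup>2 - x\<^sup>2) / (2 * y\<^sup>2 * r)))"

definition calS :: "real \<Rightarrow> real \<Rightarrow> real \<Rightarrow> real \<Rightarrow> real \<Rightarrow> real" where
  "calS \<alpha> \<beta> p rout r0 =
     (1 - p)\<^sup>2
     + 4 * r0\<^sup>2 / region_area rout * (1 - p) * p *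
         (pi / \<beta> * Psi \<alpha> \<beta> ((rout - r0) / r0) + calZ \<alpha> \<beta> 1 rout r0)
     + 2 * r0\<^sup>2 * p\<^sup>2 / region_area rout *
         (pi * calG \<alpha> \<beta> ((rout - r0) / r0) + calZ \<alpha> \<beta> 2 rout r0)"

definition polar_dist :: "real \<Rightarrow> real \<Rightarrow> real \<Rightarrow> real \<Rightarrow> real \<Rightarrow> real" where
  "polar_dist rout r0 \<rho> \<phi> \<theta> =
     cmod (of_real r0 * cis \<theta> + of_real (rout * sqrt \<rho>) * cis \<phi>) / r0"

definition calX :: "real \<Rightarrow> real \<Rightarrow> real \<Rightarrow> real \<Rightarrow> real \<Rightarrow> real" where
  "calX \<alpha> \<beta> rout r0 \<theta> =
     1 / (2 * pi) *
     integral {0..1} (\<lambda>\<rho>. integral {0..2 * pi} (\<lambda>\<phi>.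
       polar_dist rout r0 \<rho> \<phi> 0 powr \<alpha> / (\<beta> + polar_dist rout r0 \<rho> \<phi> 0 powr \<alpha>) *
       (polar_dist rout r0 \<rho> \<phi> \<theta> powr \<alpha> / (\<beta> + polar_dist rout r0 \<rho> \<phi> \<theta> powr \<alpha>))))"

definition calW :: "real \<Rightarrow> real \<Rightarrow> real \<Rightarrow> real \<Rightarrow> real \<Rightarrow> real \<Rightarrow> real" where
  "calW \<alpha> \<beta> p rout r0 \<theta> =
     (1 - p)\<^sup>2 + p\<^sup>2 * calX \<alpha> \<beta> rout r0 \<theta>
     + 4 * r0\<^sup>2 / region_area rout * (1 - p) * p *
         (pi / \<beta> * Psi \<alpha> \<beta> ((rout - r0) / r0) + calZ \<alpha> \<beta> 1 rout r0)"

end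

(*
  Given the distances, integrating out the exponential signal gain turns the success probability
  into the Laplace transform of the interference, which factorizes over the interferers; so the
  conditional outage probability is one minus a constant times a product over the points of the
  process. The moments of this product are values of the probability generating functional
  E prod_{x in Phi cap A} h x = exp (- rate * int_A (1 - h)). It is obtained from the independent
  Poisson counts of the level sets of the discretization floor (n h) / n. What remains are
  integrals over the disk of functions of the distance to a receiver, computed in polar
  coordinates around the receiver, and, for the mixed moment, around the origin.
*)
theory Submission
  imports Defs
begin

section \<open>Polar coordinates in the plane\<close>

text \<open>The process is specified only through its counts, and the enumeration \<open>X i\<close>
  only as a bijection onto its points. Hence the moments are not computed by conditioning on
  \<open>M\<close> and using uniform points: a product over the interferers does not depend on their
  order, so it is rewritten as a product over the point set. Conditioning is on the distances, but
  independence of gains and activities is given for the positions. Freezing the positions works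
  because the resulting probability depends on them only through the distances. An interferer at
  distance r contributes q = 1 - p + p l with l = r^\<alpha> / (\<beta> + r^\<alpha>). In q_a q_b =
  (1-p)^2 + p(1-p)(l_a + l_b) + p^2 l_a l_b the linear terms have the same integral for both
  receivers, so \<open>calS\<close> and \<open>calW\<close> differ only in the last term. Seen from
  a receiver, circles of relative radius up to (rout - r0) / r0 lie inside the disk and give
  \<open>Psi\<close> and \<open>calG\<close>; larger ones meet it in an arc whose half angle is the
  arccos in \<open>calZ\<close>. Two receivers have no common centre, so \<open>calX\<close> stays a
  double integral.\<close>

lemma distr_Complex_lborel:
  "distr (lborel \<Otimes>\<^sub>M lborel) borel (\<lambda>(x, y). Complex x y) = lborel"
proof (rule lborel_eqI[symmetric])
  have [measurable]: "(\<lambda>(x, y). Complex x y) \<in> borel_measurable (borel \<Otimes>\<^sub>M borel)"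
    unfolding Complex_eq by measurable
  fix l u :: complex
  assume le: "\<And>b. b \<in> Basis \<Longrightarrow> l \<bullet> b \<le> u \<bullet> b"
  have lu: "Re l \<le> Re u" "Im l \<le> Im u"
    using le[of 1] le[of \<i>] by (auto simp: Basis_complex_def)
  have vim: "(\<lambda>(x, y). Complex x y) -` box l u \<inter> space (lborel \<Otimes>\<^sub>M lborel)
      = {Re l<..<Re u} \<times> {Im l<..<Im u}"
    by (auto simp: in_box_complex_iff space_pair_measure)
  have "emeasure (distr (lborel \<Otimes>\<^sub>M lborel) borel (\<lambda>(x, y). Complex x y)) (box l u)
      = emeasure (lborel \<Otimes>\<^sub>M lborel) ({Re l<..<Re u} \<times> {Im l<..<Im u})"
    by (subst emeasure_distr) (simp_all only: vim, measurable)
  also have "\<dots> = ennreal (Re u - Re l) * ennreal (Im u - Im l)"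
    using lu by (subst lborel.emeasure_pair_measure_Times) auto
  also have "\<dots> = ennreal (\<Prod>b\<in>Basis. (u - l) \<bullet> b)"
    using lu by (simp add: Basis_complex_def ennreal_mult)
  finally show "emeasure (distr (lborel \<Otimes>\<^sub>M lborel) borel (\<lambda>(x, y). Complex x y)) (box l u)
      = ennreal (\<Prod>b\<in>Basis. (u - l) \<bullet> b)" .
qed simp

lemma nn_integral_complex:
  fixes f :: "complex \<Rightarrow> ennreal"
  assumes [measurable]: "f \<in> borel_measurable borel"
  shows "(\<integral>\<^sup>+z. f z \<partial>lborel) = (\<integral>\<^sup>+x. \<integral>\<^sup>+y. f (Complex x y) \<partial>lborel \<partial>lborel)"
proof -
  have [measurable]: "(\<lambda>(x, y). Complex x y) \<in> borel_measurable (borel \<Otimes>\<^sub>M borel)"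
    unfolding Complex_eq by measurable
  have "(\<integral>\<^sup>+z. f z \<partial>lborel) = (\<integral>\<^sup>+w. f (case w of (x, y) \<Rightarrow> Complex x y) \<partial>(lborel \<Otimes>\<^sub>M lborel))"
    by (subst distr_Complex_lborel[symmetric], subst nn_integral_distr) auto
  also have "\<dots> = (\<integral>\<^sup>+x. \<integral>\<^sup>+y. f (Complex x y) \<partial>lborel \<partial>lborel)"
    by (subst lborel.nn_integral_fst[symmetric]) auto
  finally show ?thesis .
qed

lemma borel_measurable_tan [measurable]: "(tan :: real \<Rightarrow> real) \<in> borel_measurable borel"
  unfolding tan_def[abs_def] by measurable

text \<open>A box (l, u) pulls back to (arctan l, arctan u), and the density is the derivative of
  tan, so its integral there is u - l; boxes determine Lebesgue measure. Stating the substitution as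
  a push-forward covers the unbounded range at once.\<close>

lemma distr_tan_lborel:
  "distr (density lborel (\<lambda>t. ennreal (1 / (cos t)\<^sup>2) * indicator {- (pi/2)<..<pi/2} t)) borel tan
     = lborel"
proof (rule lborel_eqI[symmetric])
  fix l u :: real
  assume "\<And>b. b \<in> Basis \<Longrightarrow> l \<bullet> b \<le> u \<bullet> b"
  then have lu: "l \<le> u" by simp
  have b: "- (pi/2) < arctan l" "arctan u < pi/2" "arctan l \<le> arctan u"
    using lu arctan_lbound arctan_ubound by (auto simp: arctan_monotone')
  have *: "indicator {- (pi/2)<..<pi/2} t * indicator (tan -` box l u) t
      = (indicator {arctan l<..<arctan u} t :: ennreal)" for t
  proof -
    have "t \<in> {- (pi/2)<..<pi/2} \<and> tan t \<in> box l u \<longleftrightarrow> t \<in> {arctan l<..<arctan u}"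
    proof
      assume "t \<in> {- (pi/2)<..<pi/2} \<and> tan t \<in> box l u"
      then show "t \<in> {arctan l<..<arctan u}"
        using arctan_tan[of t] arctan_less_iff[of l "tan t"] arctan_less_iff[of "tan t" u] by auto
    next
      assume t: "t \<in> {arctan l<..<arctan u}"
      then have "t \<in> {- (pi/2)<..<pi/2}" using b by auto
      then show "t \<in> {- (pi/2)<..<pi/2} \<and> tan t \<in> box l u"
        using arctan_tan[of t] arctan_less_iff[of l "tan t"] arctan_less_iff[of "tan t" u] t by auto
    qed
    then show ?thesis by (auto simp: indicator_def)
  qed
  have "emeasure (distr (density lborel
        (\<lambda>t. ennreal (1 / (cos t)\<^sup>2) * indicator {- (pi/2)<..<pi/2} t)) borel tan) (box l u)
      = (\<integral>\<^sup>+t. ennreal (1 / (cos t)\<^sup>2) * indicator {- (pi/2)<..<pi/2} t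
            * indicator (tan -` box l u) t \<partial>lborel)"
    by (subst emeasure_distr, simp, simp, subst emeasure_density)
       (use measurable_sets[OF borel_measurable_tan, of "{l<..<u}"] in auto)
  also have "\<dots> = (\<integral>\<^sup>+t. ennreal (1 / (cos t)\<^sup>2) * indicator {arctan l<..<arctan u} t \<partial>lborel)"
    by (simp only: mult.assoc *)
  also have "\<dots> = (\<integral>\<^sup>+t. ennreal (1 / (cos t)\<^sup>2) * indicator {arctan l..arctan u} t \<partial>lborel)"
  proof (rule nn_integral_cong_AE)
    show "AE t in lborel. ennreal (1 / (cos t)\<^sup>2) * indicator {arctan l<..<arctan u} t
        = ennreal (1 / (cos t)\<^sup>2) * indicator {arctan l..arctan u} t"
      using AE_lborel_singleton[of "arctan l"] AE_lborel_singleton[of "arctan u"]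
      by eventually_elim (auto simp: indicator_def)
  qed
  also have "\<dots> = ennreal (tan (arctan u) - tan (arctan l))"
  proof (rule nn_integral_FTC_Icc)
    fix t assume "t \<in> {arctan l..arctan u}"
    then have "- (pi/2) < t" "t < pi/2" using b by auto
    then have "cos t \<noteq> 0" using cos_gt_zero_pi[of t] by auto
    then show "(tan has_real_derivative 1 / (cos t)\<^sup>2) (at t)"
      by (auto intro!: derivative_eq_intros simp: inverse_eq_divide)
  qed (use b in auto)
  finally show "emeasure (distr (density lborel
        (\<lambda>t. ennreal (1 / (cos t)\<^sup>2) * indicator {- (pi/2)<..<pi/2} t)) borel tan) (box l u)
      = ennreal (\<Prod>b\<in>Basis. (u - l) \<bullet> b)" by (simp add: tan_arctan)
qed simp

lemma nn_integral_tan_substitution: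
  fixes h :: "real \<Rightarrow> ennreal"
  assumes [measurable]: "h \<in> borel_measurable borel"
  shows "(\<integral>\<^sup>+s. h s \<partial>lborel)
    = (\<integral>\<^sup>+t. ennreal (1 / (cos t)\<^sup>2) * indicator {- (pi/2)<..<pi/2} t * h (tan t) \<partial>lborel)"
  by (subst distr_tan_lborel[symmetric], subst nn_integral_distr)
     (auto simp: nn_integral_density)

text \<open>Substitute \<open>y = x s\<close>, then \<open>s = tan t\<close> and \<open>x = r cos t\<close>: every step is a one-dimensional substitution.\<close>

lemma nn_integral_polar_right_half_plane:
  fixes f :: "complex \<Rightarrow> ennreal"
  assumes [measurable]: "f \<in> borel_measurable borel"
  shows "(\<integral>\<^sup>+z. f z * indicator {z. Re z > 0} z \<partial>lborel)
    = (\<integral>\<^sup>+t. indicator {- (pi/2)<..<pi/2} t *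
        (\<integral>\<^sup>+r. ennreal r * indicator {0<..} r * f (of_real r * cis t) \<partial>lborel) \<partial>lborel)"
proof -
  have [measurable]: "(\<lambda>(x, y). Complex x y) \<in> borel_measurable (borel \<Otimes>\<^sub>M borel)"
    unfolding Complex_eq by measurable
  have [measurable]: "(\<lambda>z. f (Complex (fst z) (fst z * snd z))) \<in> borel_measurable (borel \<Otimes>\<^sub>M borel)"
    unfolding Complex_eq by measurable
  have [measurable]: "(\<lambda>z. f (Complex (snd z) (snd z * fst z))) \<in> borel_measurable (borel \<Otimes>\<^sub>M borel)"
    unfolding Complex_eq by measurable
  have [measurable]: "f \<circ> Complex x \<in> borel_measurable borel" for x
    unfolding comp_def Complex_eq by measurable
  have [measurable]: "(\<lambda>x. f (Complex x (x * s))) \<in> borel_measurable borel" for s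
    unfolding comp_def Complex_eq by measurable
  have [measurable]: "cis \<in> borel_measurable borel"
    unfolding cis.code Complex_eq by measurable
  let ?H = "\<lambda>s. \<integral>\<^sup>+x. ennreal x * indicator {0<..} x * f (Complex x (x * s)) \<partial>lborel"
  have "(\<integral>\<^sup>+z. f z * indicator {z. Re z > 0} z \<partial>lborel)
      = (\<integral>\<^sup>+x. \<integral>\<^sup>+y. f (Complex x y) * indicator {0<..} x \<partial>lborel \<partial>lborel)"
    by (subst nn_integral_complex) (auto simp: indicator_def intro!: nn_integral_cong)
  also have "\<dots> = (\<integral>\<^sup>+x. \<integral>\<^sup>+s. ennreal x * indicator {0<..} x * f (Complex x (x * s)) \<partial>lborel \<partial>lborel)"
  proof (rule nn_integral_cong)
    fix x :: real
    show "(\<integral>\<^sup>+y. f (Complex x y) * indicator {0<..} x \<partial>lborel)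
        = (\<integral>\<^sup>+s. ennreal x * indicator {0<..} x * f (Complex x (x * s)) \<partial>lborel)"
    proof (cases "x > 0")
      case True
      have "(\<integral>\<^sup>+y. (f \<circ> Complex x) y \<partial>lborel) = ennreal \<bar>x\<bar> * (\<integral>\<^sup>+s. (f \<circ> Complex x) (0 + x * s) \<partial>lborel)"
        by (rule nn_integral_real_affine) (use True in auto)
      also have "\<dots> = (\<integral>\<^sup>+s. ennreal \<bar>x\<bar> * (f \<circ> Complex x) (0 + x * s) \<partial>lborel)"
        by (rule nn_integral_cmult[symmetric]) measurable
      finally show ?thesis using True by simp
    qed simp
  qed
  \<comment> \<open>The slope s = y / x has to become the outer variable, since the later
    substitution x = r cos t depends on it.\<close>
  also have "\<dots> = (\<integral>\<^sup>+s. ?H s \<partial>lborel)"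
    by (subst lborel_pair.Fubini') (auto simp: case_prod_beta')
  also have "\<dots> = (\<integral>\<^sup>+t. ennreal (1 / (cos t)\<^sup>2) * indicator {- (pi/2)<..<pi/2} t * ?H (tan t) \<partial>lborel)"
    by (subst nn_integral_tan_substitution) (auto simp: case_prod_beta')
  also have "\<dots> = (\<integral>\<^sup>+t. indicator {- (pi/2)<..<pi/2} t *
        (\<integral>\<^sup>+r. ennreal r * indicator {0<..} r * f (of_real r * cis t) \<partial>lborel) \<partial>lborel)"
  proof (rule nn_integral_cong)
    fix t :: real
    show "ennreal (1 / (cos t)\<^sup>2) * indicator {- (pi/2)<..<pi/2} t * ?H (tan t) =
      indicator {- (pi/2)<..<pi/2} t *
        (\<integral>\<^sup>+r. ennreal r * indicator {0<..} r * f (of_real r * cis t) \<partial>lborel)"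
    proof (cases "t \<in> {- (pi/2)<..<pi/2}")
      case True
      then have c: "cos t > 0" using cos_gt_zero_pi[of t] by auto
      have "?H (tan t) = ennreal \<bar>cos t\<bar> * (\<integral>\<^sup>+r. ennreal (0 + cos t * r) * indicator {0<..} (0 + cos t * r)
          * f (Complex (0 + cos t * r) ((0 + cos t * r) * tan t)) \<partial>lborel)"
        by (rule nn_integral_real_affine) (use c in auto)
      also have "(\<integral>\<^sup>+r. ennreal (0 + cos t * r) * indicator {0<..} (0 + cos t * r)
          * f (Complex (0 + cos t * r) ((0 + cos t * r) * tan t)) \<partial>lborel)
        = (\<integral>\<^sup>+r. ennreal (cos t) * (ennreal r * indicator {0<..} r * f (of_real r * cis t)) \<partial>lborel)"
      proof (intro nn_integral_cong)
        fix r :: real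
        have "Complex (cos t * r) (cos t * r * tan t) = of_real r * cis t"
          using c by (simp add: complex_eq_iff tan_def)
        then show "ennreal (0 + cos t * r) * indicator {0<..} (0 + cos t * r)
            * f (Complex (0 + cos t * r) ((0 + cos t * r) * tan t))
          = ennreal (cos t) * (ennreal r * indicator {0<..} r * f (of_real r * cis t))"
          using c by (cases "r > 0") (auto simp: ennreal_mult zero_less_mult_iff mult.assoc)
      qed
      also have "\<dots> = ennreal (cos t) * (\<integral>\<^sup>+r. ennreal r * indicator {0<..} r * f (of_real r * cis t) \<partial>lborel)"
        by (rule nn_integral_cmult) auto
      \<comment> \<open>One factor cos t is the Jacobian of x = r cos t, the other comes from the
        weight x itself; together they cancel the 1 / cos^2 of the tangent substitution and leave
        the weight r.\<close>
      finally have "ennreal (1 / (cos t)\<^sup>2) * ?H (tan t)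
          = (ennreal (1 / (cos t)\<^sup>2) * (ennreal (cos t) * ennreal (cos t)))
            * (\<integral>\<^sup>+r. ennreal r * indicator {0<..} r * f (of_real r * cis t) \<partial>lborel)"
        using c by (simp add: mult.assoc)
      also have "ennreal (1 / (cos t)\<^sup>2) * (ennreal (cos t) * ennreal (cos t)) = 1"
        using c by (simp add: ennreal_mult[symmetric] power2_eq_square)
      finally show ?thesis using True by simp
    qed simp
  qed
  finally show ?thesis .
qed

section \<open>Gluing half-planes: shifts, periodicity and rotations of the angle\<close>

lemma nn_integral_shift:
  fixes K :: "real \<Rightarrow> ennreal"
  assumes [measurable]: "K \<in> borel_measurable borel"
  shows "(\<integral>\<^sup>+t. K (t + c) \<partial>lborel) = (\<integral>\<^sup>+t. K t \<partial>lborel)"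
  using nn_integral_real_affine[OF assms, of 1 c] by (simp add: add.commute)

text \<open>Moving the window [x, x + 2 pi) by less than a period removes a piece on the left and
  adds its translate on the right (\<open>near\<close>); whole periods change nothing
  (\<open>nat_period\<close>). The floor of the distance over 2 pi reduces any two windows to these
  cases. Only sums of integrals are compared, because the values may be infinite.\<close>

lemma nn_integral_periodic:
  fixes K :: "real \<Rightarrow> ennreal"
  assumes [measurable]: "K \<in> borel_measurable borel"
    and per: "\<And>t. K (t + 2 * pi) = K t"
  shows "(\<integral>\<^sup>+t. indicator {a..<a + 2 * pi} t * K t \<partial>lborel)
    = (\<integral>\<^sup>+t. indicator {b..<b + 2 * pi} t * K t \<partial>lborel)"
proof -
  have shift: "(\<integral>\<^sup>+t. indicator {x + 2 * pi..<y + 2 * pi} t * K t \<partial>lborel)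
      = (\<integral>\<^sup>+t. indicator {x..<y} t * K t \<partial>lborel)" for x y
  proof -
    have "(\<integral>\<^sup>+t. indicator {x + 2 * pi..<y + 2 * pi} t * K t \<partial>lborel)
        = (\<integral>\<^sup>+t. indicator {x + 2 * pi..<y + 2 * pi} (t + 2 * pi) * K (t + 2 * pi) \<partial>lborel)"
      by (rule nn_integral_shift[symmetric]) measurable
    also have "\<dots> = (\<integral>\<^sup>+t. indicator {x..<y} t * K t \<partial>lborel)"
      by (intro nn_integral_cong) (simp add: per indicator_def)
    finally show ?thesis .
  qed
  have split: "(\<integral>\<^sup>+t. indicator {x..<z} t * K t \<partial>lborel)
      = (\<integral>\<^sup>+t. indicator {x..<y} t * K t \<partial>lborel) + (\<integral>\<^sup>+t. indicator {y..<z} t * K t \<partial>lborel)"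
    if "x \<le> y" "y \<le> z" for x y z
    using that by (subst nn_integral_add[symmetric]) (auto intro!: nn_integral_cong simp: indicator_def)
  define h where "h x = (\<integral>\<^sup>+t. indicator {x..<x + 2 * pi} t * K t \<partial>lborel)" for x
  have near: "h y = h x" if "x \<le> y" "y < x + 2 * pi" for x y
    using split[of x y "x + 2 * pi"] split[of y "x + 2 * pi" "y + 2 * pi"] shift[of x y] that
    by (simp add: h_def add.commute)
  have nat_period: "h (x + 2 * pi * real n) = h x" for x n
  proof (induction n)
    case (Suc n)
    have "h (x + 2 * pi * real n + 2 * pi) = h (x + 2 * pi * real n)"
      unfolding h_def by (rule shift)
    then show ?case using Suc by (simp add: algebra_simps)
  qed simp
  have le: "h y = h x" if "x \<le> y" for x y
  proof -
    define n where "n = nat \<lfloor>(y - x) / (2 * pi)\<rfloor>"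
    have "real n \<le> (y - x) / (2 * pi)" "(y - x) / (2 * pi) < real n + 1"
      using that by (auto simp: n_def)
    then have "x + 2 * pi * real n \<le> y" "y < x + 2 * pi * real n + 2 * pi"
      by (auto simp: field_simps)
    then show ?thesis using near nat_period by metis
  qed
  have "h a = h b" using le[of a b] le[of b a] by (cases "a \<le> b") auto
  then show ?thesis by (simp add: h_def)
qed

lemma nn_integral_interval_endpoint:
  fixes K :: "real \<Rightarrow> ennreal"
  shows "(\<integral>\<^sup>+t. indicator {a<..<b} t * K t \<partial>lborel) = (\<integral>\<^sup>+t. indicator {a..<b} t * K t \<partial>lborel)"
    and "(\<integral>\<^sup>+t. indicator {a..b} t * K t \<partial>lborel) = (\<integral>\<^sup>+t. indicator {a..<b} t * K t \<partial>lborel)"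
proof -
  have "AE t in lborel. indicator {a<..<b} t * K t = indicator {a..<b} t * K t"
    using AE_lborel_singleton[of a] by eventually_elim (auto simp: indicator_def)
  then show "(\<integral>\<^sup>+t. indicator {a<..<b} t * K t \<partial>lborel) = (\<integral>\<^sup>+t. indicator {a..<b} t * K t \<partial>lborel)"
    by (rule nn_integral_cong_AE)
  have "AE t in lborel. indicator {a..b} t * K t = indicator {a..<b} t * K t"
    using AE_lborel_singleton[of b] by eventually_elim (auto simp: indicator_def)
  then show "(\<integral>\<^sup>+t. indicator {a..b} t * K t \<partial>lborel) = (\<integral>\<^sup>+t. indicator {a..<b} t * K t \<partial>lborel)"
    by (rule nn_integral_cong_AE)
qed

text \<open>The two half-planes of the polar formula miss the imaginary axis, which is null because
  its slices at fixed x are empty except at x = 0.\<close>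

lemma AE_lborel_Re_nonzero: "AE z in lborel. Re z \<noteq> 0"
proof (rule AE_I)
  show "{z \<in> space lborel. \<not> Re z \<noteq> 0} \<subseteq> {z. Re z = 0}" by auto
  have "emeasure lborel {z. Re z = 0} = (\<integral>\<^sup>+z. indicator {z. Re z = 0} z \<partial>lborel)"
    by (rule nn_integral_indicator[symmetric]) simp
  also have "\<dots> = (\<integral>\<^sup>+x. \<integral>\<^sup>+y. indicator {0} x \<partial>(lborel::real measure) \<partial>(lborel::real measure))"
    by (subst nn_integral_complex) (auto simp: indicator_def intro!: nn_integral_cong)
  also have "\<dots> = 0" by (simp add: nn_integral_multc)
  finally show "emeasure lborel {z. Re z = 0} = 0" .
qed simp

lemma borel_measurable_cis [measurable]: "cis \<in> borel_measurable borel"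
  unfolding cis.code Complex_eq by measurable

lemma nn_integral_lborel_uminus:
  fixes f :: "'a::euclidean_space \<Rightarrow> ennreal"
  assumes [measurable]: "f \<in> borel_measurable borel"
  shows "(\<integral>\<^sup>+z. f (- z) \<partial>lborel) = (\<integral>\<^sup>+z. f z \<partial>lborel)"
proof -
  have "(lborel :: 'a measure) = distr lborel borel uminus"
    using lborel_affine[of "-1" "0::'a"] by (simp add: density_1 scaleR_minus1_left)
  then have "(\<integral>\<^sup>+z. f z \<partial>lborel) = (\<integral>\<^sup>+z. f z \<partial>distr lborel borel uminus)" by simp
  then show ?thesis by (simp add: nn_integral_distr)
qed

text \<open>The left half-plane is the reflection of the right one, and -r cis t = r cis (t + pi),
  so it contributes the angles from pi/2 to 3 pi/2. The two arcs join to one period, which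
  periodicity moves to [0, 2 pi].\<close>

theorem nn_integral_polar:
  fixes f :: "complex \<Rightarrow> ennreal"
  assumes [measurable]: "f \<in> borel_measurable borel"
  shows "(\<integral>\<^sup>+z. f z \<partial>lborel) = (\<integral>\<^sup>+t. indicator {0..2 * pi} t *
        (\<integral>\<^sup>+r. ennreal r * indicator {0<..} r * f (of_real r * cis t) \<partial>lborel) \<partial>lborel)"
proof -
  define K where "K t = (\<integral>\<^sup>+r. ennreal r * indicator {0<..} r * f (of_real r * cis t) \<partial>lborel)" for t
  have K [measurable]: "K \<in> borel_measurable borel"
    unfolding K_def by measurable
  have per: "K (t + 2 * pi) = K t" for t
    by (simp add: K_def cis_mult[symmetric])
  have neg: "(\<integral>\<^sup>+r. ennreal r * indicator {0<..} r * f (- (of_real r * cis t)) \<partial>lborel) = K (t + pi)" for t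
    by (simp add: K_def cis_mult[symmetric])
  have "(\<integral>\<^sup>+z. f z \<partial>lborel)
      = (\<integral>\<^sup>+z. f z * indicator {z. Re z > 0} z + f z * indicator {z. Re z < 0} z \<partial>lborel)"
    by (rule nn_integral_cong_AE, use AE_lborel_Re_nonzero in eventually_elim)
       (auto simp: indicator_def)
  also have "\<dots> = (\<integral>\<^sup>+z. f z * indicator {z. Re z > 0} z \<partial>lborel)
      + (\<integral>\<^sup>+z. f z * indicator {z. Re z < 0} z \<partial>lborel)"
    by (rule nn_integral_add) auto
  also have "(\<integral>\<^sup>+z. f z * indicator {z. Re z < 0} z \<partial>lborel)
      = (\<integral>\<^sup>+z. f (- z) * indicator {z. Re z < 0} (- z) \<partial>lborel)"
    by (rule nn_integral_lborel_uminus[symmetric]) measurable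
  also have "\<dots> = (\<integral>\<^sup>+z. f (- z) * indicator {z. Re z > 0} z \<partial>lborel)"
    by (intro nn_integral_cong) (auto simp: indicator_def)
  also have "\<dots> = (\<integral>\<^sup>+t. indicator {- (pi/2)<..<pi/2} t * K (t + pi) \<partial>lborel)"
    by (subst nn_integral_polar_right_half_plane) (auto simp: neg)
  also have "\<dots> = (\<integral>\<^sup>+t. indicator {pi/2<..<3*pi/2} (t + pi) * K (t + pi) \<partial>lborel)"
    by (intro nn_integral_cong) (auto simp: indicator_def)
  also have "\<dots> = (\<integral>\<^sup>+t. indicator {pi/2<..<3*pi/2} t * K t \<partial>lborel)"
    by (rule nn_integral_shift) measurable
  also have "\<dots> = (\<integral>\<^sup>+t. indicator {pi/2..<3*pi/2} t * K t \<partial>lborel)"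
    by (rule nn_integral_interval_endpoint)
  also have "(\<integral>\<^sup>+z. f z * indicator {z. Re z > 0} z \<partial>lborel)
      = (\<integral>\<^sup>+t. indicator {- (pi/2)<..<pi/2} t * K t \<partial>lborel)"
    by (subst nn_integral_polar_right_half_plane) (auto simp: K_def)
  also have "\<dots> = (\<integral>\<^sup>+t. indicator {- (pi/2)..<pi/2} t * K t \<partial>lborel)"
    by (rule nn_integral_interval_endpoint)
  also have "(\<integral>\<^sup>+t. indicator {- (pi/2)..<pi/2} t * K t \<partial>lborel)
      + (\<integral>\<^sup>+t. indicator {pi/2..<3*pi/2} t * K t \<partial>lborel)
    = (\<integral>\<^sup>+t. indicator {- (pi/2)..<- (pi/2) + 2 * pi} t * K t \<partial>lborel)"
    by (subst nn_integral_add[symmetric]) (auto intro!: nn_integral_cong simp: indicator_def)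
  also have "\<dots> = (\<integral>\<^sup>+t. indicator {0..<0 + 2 * pi} t * K t \<partial>lborel)"
    by (rule nn_integral_periodic) (auto simp: per)
  also have "\<dots> = (\<integral>\<^sup>+t. indicator {0..2 * pi} t * K t \<partial>lborel)"
    by (simp add: nn_integral_interval_endpoint)
  finally show ?thesis by (simp add: K_def)
qed

text \<open>A rotation adds \<theta> to the angle, and the integral over a full period does not
  depend on where the period starts. It serves to turn a receiver onto the positive real
  axis.\<close>

lemma nn_integral_cis_rotate:
  fixes f :: "complex \<Rightarrow> ennreal"
  assumes [measurable]: "f \<in> borel_measurable borel"
  shows "(\<integral>\<^sup>+z. f (cis \<theta> * z) \<partial>lborel) = (\<integral>\<^sup>+z. f z \<partial>lborel)"
proof -
  define K where "K t = (\<integral>\<^sup>+r. ennreal r * indicator {0<..} r * f (of_real r * cis t) \<partial>lborel)" for t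
  have [measurable]: "K \<in> borel_measurable borel"
    unfolding K_def by measurable
  have per: "K (t + 2 * pi) = K t" for t
    by (simp add: K_def cis_mult[symmetric])
  have rot: "(\<integral>\<^sup>+r. ennreal r * indicator {0<..} r * f (cis \<theta> * (of_real r * cis t)) \<partial>lborel) = K (t + \<theta>)" for t
    by (simp add: K_def cis_mult[symmetric] mult_ac)
  have "(\<integral>\<^sup>+z. f (cis \<theta> * z) \<partial>lborel) = (\<integral>\<^sup>+t. indicator {0..2 * pi} t * K (t + \<theta>) \<partial>lborel)"
    by (subst nn_integral_polar) (auto simp: rot)
  also have "\<dots> = (\<integral>\<^sup>+t. indicator {0..<2 * pi} t * K (t + \<theta>) \<partial>lborel)"
    by (rule nn_integral_interval_endpoint)
  also have "\<dots> = (\<integral>\<^sup>+t. indicator {\<theta>..<\<theta> + 2 * pi} (t + \<theta>) * K (t + \<theta>) \<partial>lborel)"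
    by (intro nn_integral_cong) (auto simp: indicator_def)
  also have "\<dots> = (\<integral>\<^sup>+t. indicator {\<theta>..<\<theta> + 2 * pi} t * K t \<partial>lborel)"
    by (rule nn_integral_shift) measurable
  also have "\<dots> = (\<integral>\<^sup>+t. indicator {0..<0 + 2 * pi} t * K t \<partial>lborel)"
    by (rule nn_integral_periodic) (auto simp: per)
  also have "\<dots> = (\<integral>\<^sup>+t. indicator {0..2 * pi} t * K t \<partial>lborel)"
    by (simp add: nn_integral_interval_endpoint)
  also have "\<dots> = (\<integral>\<^sup>+z. f z \<partial>lborel)"
    by (subst nn_integral_polar) (auto simp: K_def)
  finally show ?thesis .
qed

text \<open>With the radius outside, an integrand that depends on the radius alone leaves on each
  circle only the length of the arc inside the disk.\<close>

lemma nn_integral_polar_swap: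
  fixes f :: "complex \<Rightarrow> ennreal"
  assumes [measurable]: "f \<in> borel_measurable borel"
  shows "(\<integral>\<^sup>+z. f z \<partial>lborel) = (\<integral>\<^sup>+r. ennreal r * indicator {0<..} r *
        (\<integral>\<^sup>+t. indicator {0..2 * pi} t * f (of_real r * cis t) \<partial>lborel) \<partial>lborel)"
proof -
  have "(\<integral>\<^sup>+z. f z \<partial>lborel) = (\<integral>\<^sup>+t. \<integral>\<^sup>+r. indicator {0..2 * pi} t *
        (ennreal r * indicator {0<..} r * f (of_real r * cis t)) \<partial>lborel \<partial>lborel)"
    by (simp add: nn_integral_polar nn_integral_cmult)
  also have "\<dots> = (\<integral>\<^sup>+r. \<integral>\<^sup>+t. indicator {0..2 * pi} t *
        (ennreal r * indicator {0<..} r * f (of_real r * cis t)) \<partial>lborel \<partial>lborel)"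
    by (subst lborel_pair.Fubini') (auto simp: case_prod_beta')
  also have "\<dots> = (\<integral>\<^sup>+r. \<integral>\<^sup>+t. (ennreal r * indicator {0<..} r) *
        (indicator {0..2 * pi} t * f (of_real r * cis t)) \<partial>lborel \<partial>lborel)"
    by (intro nn_integral_cong) (simp add: mult_ac)
  also have "\<dots> = (\<integral>\<^sup>+r. ennreal r * indicator {0<..} r *
        (\<integral>\<^sup>+t. indicator {0..2 * pi} t * f (of_real r * cis t) \<partial>lborel) \<partial>lborel)"
    by (simp add: nn_integral_cmult)
  finally show ?thesis .
qed

section \<open>Integrals over a disk\<close>

text \<open>Bridge from the nonnegative Lebesgue integral, in which the substitutions are done, to
  the gauge integral in which \<open>Psi\<close>, \<open>calG\<close>, \<open>calZ\<close> and
  \<open>calX\<close> are written; the bound \<open>C\<close> supplies integrability. Measurability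
  is asked only of the product with the indicator, as arccos is controlled only where its argument
  lies in [-1, 1].\<close>

lemma nn_integral_Icc_eq_integral:
  fixes g :: "real \<Rightarrow> real"
  assumes meas: "(\<lambda>x. indicator {a..b} x * g x) \<in> borel_measurable borel"
    and bnd: "\<And>x. x \<in> {a..b} \<Longrightarrow> 0 \<le> g x \<and> g x \<le> C"
  shows "(\<integral>\<^sup>+x. indicator {a..b} x * ennreal (g x) \<partial>lborel) = ennreal (integral {a..b} g)"
    and "0 \<le> integral {a..b} g"
    and "integral {a..b} g \<le> max 0 (b - a) * C"
proof -
  have int: "set_integrable lborel {a..b} g"
    unfolding set_integrable_def
  proof (rule Bochner_Integration.integrable_bound)
    show "integrable lborel (\<lambda>x. indicator {a..b} x *\<^sub>R C)"
      by (auto intro!: integrable_scaleR_left integrable_real_indicator simp: emeasure_lborel_Icc_eq)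
    show "AE x in lborel. norm (indicator {a..b} x *\<^sub>R g x) \<le> norm (indicator {a..b} x *\<^sub>R C)"
      using bnd by (intro AE_I2) (force simp: indicator_def)
  qed (use meas in auto)
  note hk = set_borel_integral_eq_integral[OF int]
  have "(\<integral>\<^sup>+x. indicator {a..b} x * ennreal (g x) \<partial>lborel)
      = (\<integral>\<^sup>+x. ennreal (indicator {a..b} x *\<^sub>R g x) \<partial>lborel)"
    by (intro nn_integral_cong) (auto simp: indicator_def)
  also have "\<dots> = ennreal (LINT x:{a..b}|lborel. g x)"
    unfolding set_lebesgue_integral_def
    by (rule nn_integral_eq_integral) (use int bnd in \<open>auto simp: set_integrable_def indicator_def\<close>)
  finally show "(\<integral>\<^sup>+x. indicator {a..b} x * ennreal (g x) \<partial>lborel) = ennreal (integral {a..b} g)"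
    by (simp add: hk(2))
  show "0 \<le> integral {a..b} g"
    by (rule Henstock_Kurzweil_Integration.integral_nonneg[OF hk(1)]) (use bnd in auto)
  have "integral {a..b} g \<le> integral {a..b} (\<lambda>_. C)"
    by (rule integral_le[OF hk(1)]) (use bnd in auto)
  then show "integral {a..b} g \<le> max 0 (b - a) * C"
    by (cases "a \<le> b") (auto simp: max_def)
qed

lemma set_integral_eq_of_nn_integral:
  fixes h :: "'a \<Rightarrow> real"
  assumes [measurable]: "h \<in> borel_measurable M" "A \<in> sets M"
    and "\<And>z. 0 \<le> h z" and c: "0 \<le> c"
    and nn: "(\<integral>\<^sup>+z. indicator A z * ennreal (h z) \<partial>M) = ennreal c"
  shows "(LINT z:A|M. h z) = c"
proof -
  have "(LINT z:A|M. h z) = enn2real (\<integral>\<^sup>+z. ennreal (indicator A z *\<^sub>R h z) \<partial>M)"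
    unfolding set_lebesgue_integral_def
    by (rule integral_eq_nn_integral) (use assms(3) in auto)
  also have "(\<integral>\<^sup>+z. ennreal (indicator A z *\<^sub>R h z) \<partial>M) = (\<integral>\<^sup>+z. indicator A z * ennreal (h z) \<partial>M)"
    by (intro nn_integral_cong) (auto simp: indicator_def)
  finally show ?thesis using c by (simp add: nn)
qed

text \<open>The substitution \<rho> = (r / R)^2 turns r dr into R^2 / 2 d\<rho>: for a uniform point
  of the disk, \<rho> is uniform in [0, 1]. This is the origin of the square root in
  \<open>polar_dist\<close>.\<close>

lemma set_integral_disk_polar:
  fixes h :: "complex \<Rightarrow> real"
  assumes [measurable]: "h \<in> borel_measurable borel"
    and h: "\<And>z. 0 \<le> h z" "\<And>z. h z \<le> 1" and R: "0 < R"
  shows "(LINT z:cball 0 R|lborel. h z)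
    = R\<^sup>2 / 2 * integral {0..1} (\<lambda>\<rho>. integral {0..2 * pi}
        (\<lambda>t. h (of_real (R * sqrt \<rho>) * cis t)))"
proof (rule set_integral_eq_of_nn_integral)
  have [measurable]: "cball (0 :: complex) R \<in> sets borel" by simp
  define A where "A r = integral {0..2 * pi} (\<lambda>t. h (of_real r * cis t))" for r
  have angle: "(\<integral>\<^sup>+t. indicator {0..2 * pi} t * ennreal (h (of_real r * cis t)) \<partial>lborel) = ennreal (A r)"
    and A: "0 \<le> A r" "A r \<le> 2 * pi" for r
    using nn_integral_Icc_eq_integral[of 0 "2 * pi" "\<lambda>t. h (of_real r * cis t)" 1] h
    by (auto simp: A_def)
  \<comment> \<open>A gauge integral with a parameter gets its measurability in r from the equal
    Lebesgue integral.\<close>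
  have "A = (\<lambda>r. enn2real (\<integral>\<^sup>+t. indicator {0..2 * pi} t * ennreal (h (of_real r * cis t)) \<partial>lborel))"
    by (simp add: angle A fun_eq_iff)
  then have A_meas [measurable]: "A \<in> borel_measurable borel"
    by (simp del: angle) measurable
  have nonneg: "0 \<le> integral {0..1} (\<lambda>\<rho>. A (R * sqrt \<rho>))"
    by (rule nn_integral_Icc_eq_integral(2)[where C = "2 * pi"]) (auto simp: A)
  have "(\<integral>\<^sup>+z. indicator (cball 0 R) z * ennreal (h z) \<partial>lborel)
      = (\<integral>\<^sup>+r. ennreal r * indicator {0<..} r * (\<integral>\<^sup>+t. indicator {0..2 * pi} t *
          (indicator (cball 0 R) (of_real r * cis t) * ennreal (h (of_real r * cis t))) \<partial>lborel) \<partial>lborel)"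
    by (rule nn_integral_polar_swap) measurable
  \<comment> \<open>To match the substitution rule, r is written as R sqrt ((r / R)^2) inside
    \<open>A\<close>, and the weight r as R^2 / 2 times 2 r / R^2, the derivative of (r /
    R)^2.\<close>
  also have "\<dots> = (\<integral>\<^sup>+r. ennreal (R\<^sup>2 / 2) * (ennreal (A (R * sqrt ((r / R)\<^sup>2))) * ennreal (2 * r / R\<^sup>2)
      * indicator {0..R} r) \<partial>lborel)"
  proof (rule nn_integral_cong)
    fix r :: real
    have "(\<integral>\<^sup>+t. indicator {0..2 * pi} t *
          (indicator (cball 0 R) (of_real r * cis t) * ennreal (h (of_real r * cis t))) \<partial>lborel)
        = indicator {..R} r * ennreal (A r)" if "r > 0"
      unfolding angle[symmetric] using that
      by (subst nn_integral_cmult[symmetric])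
         (auto intro!: nn_integral_cong simp: indicator_def norm_mult)
    moreover have "ennreal r = ennreal (R\<^sup>2 / 2) * ennreal (2 * r / R\<^sup>2)" if "r > 0"
      using that R by (simp add: ennreal_mult[symmetric])
    moreover have "R * sqrt ((r / R)\<^sup>2) = r" if "r > 0"
      using that R by simp
    ultimately show "ennreal r * indicator {0<..} r * (\<integral>\<^sup>+t. indicator {0..2 * pi} t *
          (indicator (cball 0 R) (of_real r * cis t) * ennreal (h (of_real r * cis t))) \<partial>lborel)
        = ennreal (R\<^sup>2 / 2) * (ennreal (A (R * sqrt ((r / R)\<^sup>2))) * ennreal (2 * r / R\<^sup>2)
            * indicator {0..R} r)"
      by (cases "r > 0") (auto simp: indicator_def mult_ac)
  qed
  also have "\<dots> = ennreal (R\<^sup>2 / 2) * (\<integral>\<^sup>+r. ennreal (A (R * sqrt ((r / R)\<^sup>2))) * ennreal (2 * r / R\<^sup>2)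
      * indicator {0..R} r \<partial>lborel)"
    by (rule nn_integral_cmult) measurable
  also have "(\<integral>\<^sup>+r. ennreal (A (R * sqrt ((r / R)\<^sup>2))) * ennreal (2 * r / R\<^sup>2)
      * indicator {0..R} r \<partial>lborel)
      = (\<integral>\<^sup>+\<rho>. ennreal (A (R * sqrt \<rho>)) * indicator {(0 / R)\<^sup>2..(R / R)\<^sup>2} \<rho> \<partial>lborel)"
  proof (rule nn_integral_substitution_aux[symmetric])
    show "((\<lambda>r. (r / R)\<^sup>2) has_real_derivative 2 * r / R\<^sup>2) (at r)" for r
      using R by (auto intro!: derivative_eq_intros simp: power2_eq_square)
    show "continuous_on {0..R} (\<lambda>r. 2 * r / R\<^sup>2)"
      using R by (intro continuous_intros) auto
  qed (use R in auto)
  also have "\<dots> = (\<integral>\<^sup>+\<rho>. indicator {0..1} \<rho> * ennreal (A (R * sqrt \<rho>)) \<partial>lborel)"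
    using R by (simp add: mult.commute)
  also have "\<dots> = ennreal (integral {0..1} (\<lambda>\<rho>. A (R * sqrt \<rho>)))"
    by (rule nn_integral_Icc_eq_integral[where C = "2 * pi"]) (auto simp: A)
  also have "ennreal (R\<^sup>2 / 2) * \<dots> = ennreal (R\<^sup>2 / 2 * integral {0..1} (\<lambda>\<rho>. A (R * sqrt \<rho>)))"
    using nonneg by (subst ennreal_mult) auto
  finally show "(\<integral>\<^sup>+z. indicator (cball 0 R) z * ennreal (h z) \<partial>lborel)
    = ennreal (R\<^sup>2 / 2 * integral {0..1} (\<lambda>\<rho>. integral {0..2 * pi}
        (\<lambda>t. h (of_real (R * sqrt \<rho>) * cis t))))"
    by (simp add: A_def)
  show "0 \<le> R\<^sup>2 / 2 * integral {0..1} (\<lambda>\<rho>. integral {0..2 * pi}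
        (\<lambda>t. h (of_real (R * sqrt \<rho>) * cis t)))"
    using nonneg by (simp add: A_def)
qed (use h in auto)

text \<open>By |1 + r cis t|^2 = 1 + r^2 + 2 r cos t the condition is cos t \<le> -c, with c the
  argument of arccos. The disk has centre -1 and, as k \<ge> 1, contains 0: circles of radius below
  k - 1 lie inside it (c < -1), those beyond k + 1 outside (c > 1). In between the arc is centred at
  t = pi.\<close>

lemma arc_length_in_shifted_disk:
  assumes r: "r > 0" and k: "k \<ge> 1"
  shows "(\<integral>\<^sup>+t. indicator {0..2 * pi} t * indicator {w. cmod (1 + w) \<le> k} (of_real r * cis t) \<partial>lborel)
    = ennreal (if r < k - 1 then 2 * pi
        else if r \<le> k + 1 then 2 * arccos ((r\<^sup>2 + 1 - k\<^sup>2) / (2 * r)) else 0)"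
proof -
  define c where "c = (r\<^sup>2 + 1 - k\<^sup>2) / (2 * r)"
  have sq: "(cmod (1 + of_real r * cis t))\<^sup>2 = 1 + r\<^sup>2 + 2 * r * cos t" for t
  proof -
    have "(cmod (1 + of_real r * cis t))\<^sup>2 = (1 + r * cos t)\<^sup>2 + (r * sin t)\<^sup>2"
      by (simp add: cmod_power2)
    also have "\<dots> = 1 + r\<^sup>2 + 2 * r * cos t"
      using sin_cos_squared_add[of t] by algebra
    finally show ?thesis .
  qed
  have iff: "cmod (1 + of_real r * cis t) \<le> k \<longleftrightarrow> cos t \<le> - c" for t
  proof -
    have "cmod (1 + of_real r * cis t) \<le> k \<longleftrightarrow> (cmod (1 + of_real r * cis t))\<^sup>2 \<le> k\<^sup>2"
      using k by (simp add: abs_le_square_iff[symmetric])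
    also have "\<dots> \<longleftrightarrow> 2 * r * cos t \<le> k\<^sup>2 - r\<^sup>2 - 1" by (auto simp: sq)
    also have "\<dots> \<longleftrightarrow> cos t \<le> - c" using r by (simp add: c_def field_simps)
    finally show ?thesis .
  qed
  consider "r < k - 1" | "k - 1 \<le> r" "r \<le> k + 1" | "r > k + 1" by linarith
  then show ?thesis
  proof cases
    case 1
    have "(r + 1)\<^sup>2 < k\<^sup>2" using 1 r by (intro power_strict_mono) auto
    then have "c < -1" using r by (simp add: c_def field_simps power2_eq_square)
    then have "cmod (1 + of_real r * cis t) \<le> k" for t
      using cos_le_one[of t] by (subst iff) linarith
    then show ?thesis using 1 by simp
  next
    case 2
    have "(k - 1)\<^sup>2 \<le> r\<^sup>2" using 2 k by (intro power_mono) auto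
    moreover have "(r - 1)\<^sup>2 \<le> k\<^sup>2" using 2 k by (intro abs_le_square_iff[THEN iffD1]) auto
    moreover have "k\<^sup>2 \<le> (r + 1)\<^sup>2" using 2 k by (intro power_mono) auto
    ultimately have c: "-1 \<le> c" "c \<le> 1" using r by (auto simp: c_def field_simps power2_eq_square)
    have ac: "0 \<le> arccos c" "arccos c \<le> pi" using c by (auto intro: arccos_lbound arccos_ubound)
    have eq: "t \<in> {0..2 * pi} \<and> cos t \<le> - c \<longleftrightarrow> t \<in> {pi - arccos c..pi + arccos c}" for t
    proof -
      \<comment> \<open>Measured from pi, where cos is least, the angle lies in [0, pi], on which
        cos is decreasing.\<close>
      have "cos t \<le> - c \<longleftrightarrow> \<bar>t - pi\<bar> \<le> arccos c" if t: "t \<in> {0..2 * pi}"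
      proof -
        have "cos t = - cos \<bar>t - pi\<bar>" by (simp add: cos_diff)
        then have "cos t \<le> - c \<longleftrightarrow> cos (arccos c) \<le> cos \<bar>t - pi\<bar>" using c by auto
        also have "\<dots> \<longleftrightarrow> \<bar>t - pi\<bar> \<le> arccos c"
          using t ac by (subst cos_mono_le_eq) auto
        finally show ?thesis .
      qed
      then show ?thesis using ac by auto
    qed
    have "(\<integral>\<^sup>+t. indicator {0..2 * pi} t * indicator {w. cmod (1 + w) \<le> k} (of_real r * cis t) \<partial>lborel)
        = (\<integral>\<^sup>+t. indicator {pi - arccos c..pi + arccos c} t \<partial>lborel)"
      using eq by (intro nn_integral_cong) (auto simp: indicator_def iff)
    also have "\<dots> = ennreal (2 * arccos c)" using ac by simp
    finally show ?thesis using 2 by (simp add: c_def)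
  next
    case 3
    have "k\<^sup>2 < (r - 1)\<^sup>2" using 3 k by (intro power_strict_mono) auto
    then have "c > 1" using r by (simp add: c_def field_simps power2_eq_square)
    then have "\<not> cmod (1 + of_real r * cis t) \<le> k" for t
      using cos_ge_minus_one[of t] by (subst iff) linarith
    then show ?thesis using 3 by simp
  qed
qed

text \<open>The affine map z = y cis \<theta> + y w and a rotation by -\<theta> put the receiver at
  0 and turn the disk into |1 + w| \<le> k with k = x / y. The integrand then depends on |w| only,
  and each circle contributes its arc length; y^2 is the Jacobian.\<close>

lemma set_integral_off_centre_disk:
  fixes F :: "real \<Rightarrow> real"
  assumes [measurable]: "F \<in> borel_measurable borel"
    and F: "\<And>x. 0 \<le> F x" "\<And>x. F x \<le> 1" and y: "0 < y" "y \<le> x"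
  shows "(LINT z:cball 0 x|lborel. F (cmod (z - of_real y * cis \<theta>) / y))
    = 2 * y\<^sup>2 * (pi * integral {0..(x - y) / y} (\<lambda>r. r * F r)
        + integral {(x - y) / y..(x + y) / y}
            (\<lambda>r. r * F r * arccos ((y\<^sup>2 * r\<^sup>2 + y\<^sup>2 - x\<^sup>2) / (2 * y\<^sup>2 * r))))"
    (is "_ = ?V")
proof (rule set_integral_eq_of_nn_integral)
  define k where "k = x / y"
  have k: "k \<ge> 1" "(x - y) / y = k - 1" "(x + y) / y = k + 1"
    using y by (auto simp: k_def diff_divide_distrib add_divide_distrib)
  have arg: "(y\<^sup>2 * r\<^sup>2 + y\<^sup>2 - x\<^sup>2) / (2 * y\<^sup>2 * r) = (r\<^sup>2 + 1 - k\<^sup>2) / (2 * r)" for r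
  proof -
    have "y\<^sup>2 * r\<^sup>2 + y\<^sup>2 - x\<^sup>2 = y\<^sup>2 * (r\<^sup>2 + 1 - k\<^sup>2)"
      using y by (simp add: k_def field_simps)
    then show ?thesis using y by simp
  qed
  define c where "c r = (r\<^sup>2 + 1 - k\<^sup>2) / (2 * r)" for r
  have c: "-1 \<le> c r" "c r \<le> 1" if "r \<in> {k - 1..k + 1}" for r
  proof -
    have r0: "r \<ge> 0" using that k by auto
    have "(k - 1)\<^sup>2 \<le> r\<^sup>2" using that k by (intro power_mono) auto
    moreover have "(r - 1)\<^sup>2 \<le> k\<^sup>2" using that k by (intro abs_le_square_iff[THEN iffD1]) auto
    moreover have "k\<^sup>2 \<le> (r + 1)\<^sup>2" using that k by (intro power_mono) auto
    \<comment> \<open>The case r = 0 occurs only for k = 1; division by zero gives c 0 = 0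
      there.\<close>
    ultimately show "-1 \<le> c r" "c r \<le> 1"
      using r0 by (cases "r = 0"; simp add: c_def field_simps power2_eq_square)+
  qed
  \<comment> \<open>Clamping the argument to [-1, 1] makes arccos continuous on the whole line
    without changing it on the interval of integration.\<close>
  have clamp: "(\<lambda>v. arccos (max (-1) (min 1 v))) \<in> borel_measurable borel"
    by (intro borel_measurable_continuous_onI continuous_intros) auto
  have arccos_meas: "(\<lambda>r. indicator {k - 1..k + 1} r * arccos (c r)) \<in> borel_measurable borel"
  proof -
    have "(\<lambda>r. indicator {k - 1..k + 1} r * arccos (c r))
        = (\<lambda>r. indicator {k - 1..k + 1} r * (\<lambda>v. arccos (max (-1) (min 1 v))) (c r))"
    proof
      fix r show "indicator {k - 1..k + 1} r * arccos (c r)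
        = indicator {k - 1..k + 1} r * (\<lambda>v. arccos (max (-1) (min 1 v))) (c r)"
        using c[of r] by (cases "r \<in> {k - 1..k + 1}") auto
    qed
    moreover have "c \<in> borel_measurable borel" unfolding c_def[abs_def] by measurable
    ultimately show ?thesis
      using measurable_compose[OF _ clamp, of c borel] by simp
  qed
  have meas: "(\<lambda>r. indicator {k - 1..k + 1} r * (r * F r * arccos (c r))) \<in> borel_measurable borel"
  proof -
    have "(\<lambda>r. indicator {k - 1..k + 1} r * (r * F r * arccos (c r)))
        = (\<lambda>r. r * F r * (indicator {k - 1..k + 1} r * arccos (c r)))"
      by (simp add: fun_eq_iff mult_ac)
    then show ?thesis using arccos_meas by simp
  qed
  have bnd: "0 \<le> r * F r * arccos (c r) \<and> r * F r * arccos (c r) \<le> (k + 1) * 1 * pi"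
    if "r \<in> {k - 1..k + 1}" for r
  proof -
    have r: "0 \<le> r" "r \<le> k + 1" using that k by auto
    have "r * F r \<le> (k + 1) * 1" using r F[of r] by (intro mult_mono) auto
    moreover have "0 \<le> r * F r" using r F[of r] by simp
    moreover have "0 \<le> arccos (c r)" "arccos (c r) \<le> pi"
      using c[OF that] by (auto intro: arccos_lbound arccos_ubound)
    ultimately show ?thesis using k r F[of r] by (intro conjI mult_mono mult_nonneg_nonneg) auto
  qed
  have meas': "(\<lambda>r. indicator {0..k - 1} r * (r * F r)) \<in> borel_measurable borel" by measurable
  have bnd': "0 \<le> r * F r \<and> r * F r \<le> (k - 1) * 1" if "r \<in> {0..k - 1}" for r
    using that F[of r] by (intro conjI mult_mono mult_nonneg_nonneg) auto
  define f where "f z = indicator {w. cmod (1 + w) \<le> k} z * ennreal (F (cmod z))" for z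
  have f_meas [measurable]: "f \<in> borel_measurable borel" unfolding f_def[abs_def] by measurable
  let ?t = "of_real y * cis \<theta> :: complex"
  have [measurable]: "cball (0 :: complex) x \<in> sets borel" by simp
  define H where "H z = indicator (cball 0 x) z * ennreal (F (cmod (z - ?t) / y))" for z
  have [measurable]: "H \<in> borel_measurable borel" unfolding H_def[abs_def] by measurable
  have "(\<integral>\<^sup>+z. H z \<partial>lborel)
      = (\<integral>\<^sup>+z. H z \<partial>density (distr lborel borel (\<lambda>w. ?t + y *\<^sub>R w)) (\<lambda>_. \<bar>y\<bar> ^ DIM(complex)))"
    using lborel_affine[of y ?t] y by simp
  also have "\<dots> = ennreal (y\<^sup>2) * (\<integral>\<^sup>+w. H (?t + y *\<^sub>R w) \<partial>lborel)"
    using y by (simp add: nn_integral_density nn_integral_distr nn_integral_cmult)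
  finally have "(\<integral>\<^sup>+z. indicator (cball 0 x) z * ennreal (F (cmod (z - ?t) / y)) \<partial>lborel)
      = ennreal (y\<^sup>2) * (\<integral>\<^sup>+w. indicator (cball 0 x) (?t + y *\<^sub>R w)
          * ennreal (F (cmod (y *\<^sub>R w) / y)) \<partial>lborel)"
    by (simp add: H_def)
  also have "(\<integral>\<^sup>+w. indicator (cball 0 x) (?t + y *\<^sub>R w) * ennreal (F (cmod (y *\<^sub>R w) / y)) \<partial>lborel)
      = (\<integral>\<^sup>+w. f (cis (- \<theta>) * w) \<partial>lborel)"
  proof (rule nn_integral_cong)
    fix w
    have "of_real y * cis \<theta> * (cis (- \<theta>) * w) = of_real y * (cis \<theta> * cis (- \<theta>)) * w"
      by (simp only: mult.assoc)
    also have "\<dots> = y *\<^sub>R w" by (simp add: cis_mult scaleR_conv_of_real)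
    finally have "?t + y *\<^sub>R w = of_real y * cis \<theta> * (1 + cis (- \<theta>) * w)"
      by (simp only: distrib_left mult_1_right)
    then have "cmod (?t + y *\<^sub>R w) = y * cmod (1 + cis (- \<theta>) * w)"
      using y by (simp add: norm_mult)
    then show "indicator (cball 0 x) (?t + y *\<^sub>R w) * ennreal (F (cmod (y *\<^sub>R w) / y)) = f (cis (- \<theta>) * w)"
      using y by (simp add: f_def indicator_def norm_mult k_def field_simps)
  qed
  also have "\<dots> = (\<integral>\<^sup>+w. f w \<partial>lborel)" by (rule nn_integral_cis_rotate) measurable
  also have "\<dots> = (\<integral>\<^sup>+r. ennreal r * indicator {0<..} r *
        (\<integral>\<^sup>+t. indicator {0..2 * pi} t * f (of_real r * cis t) \<partial>lborel) \<partial>lborel)"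
    by (rule nn_integral_polar_swap) measurable
  also have "\<dots> = (\<integral>\<^sup>+r. ennreal (2 * pi) * (indicator {0..k - 1} r * ennreal (r * F r))
      + 2 * (indicator {k - 1..k + 1} r * ennreal (r * F r * arccos (c r))) \<partial>lborel)"
  \<comment> \<open>At r = k - 1 the two closed intervals overlap, and the right side would count
    that circle twice; the point is null.\<close>
  proof (rule nn_integral_cong_AE, use AE_lborel_singleton[of "k - 1"] AE_lborel_singleton[of 0] in eventually_elim)
    fix r :: real assume r: "r \<noteq> k - 1" "r \<noteq> 0"
    show "ennreal r * indicator {0<..} r *
        (\<integral>\<^sup>+t. indicator {0..2 * pi} t * f (of_real r * cis t) \<partial>lborel)
      = ennreal (2 * pi) * (indicator {0..k - 1} r * ennreal (r * F r))
        + 2 * (indicator {k - 1..k + 1} r * ennreal (r * F r * arccos (c r)))"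
    proof (cases "r > 0")
      case True
      have "(\<integral>\<^sup>+t. indicator {0..2 * pi} t * f (of_real r * cis t) \<partial>lborel)
          = (\<integral>\<^sup>+t. ennreal (F r) * (indicator {0..2 * pi} t *
              indicator {w. cmod (1 + w) \<le> k} (of_real r * cis t)) \<partial>lborel)"
        using True by (intro nn_integral_cong) (simp add: f_def norm_mult mult_ac)
      also have "\<dots> = ennreal (F r) * (\<integral>\<^sup>+t. indicator {0..2 * pi} t *
              indicator {w. cmod (1 + w) \<le> k} (of_real r * cis t) \<partial>lborel)"
        by (rule nn_integral_cmult) measurable
      also have "\<dots> = ennreal (F r) * ennreal (if r < k - 1 then 2 * pi
          else if r \<le> k + 1 then 2 * arccos (c r) else 0)"
        using arc_length_in_shifted_disk[OF True k(1)] by (simp add: c_def)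
      finally have *: "(\<integral>\<^sup>+t. indicator {0..2 * pi} t * f (of_real r * cis t) \<partial>lborel)
          = ennreal (F r) * ennreal (if r < k - 1 then 2 * pi
              else if r \<le> k + 1 then 2 * arccos (c r) else 0)" .
      have ac: "0 \<le> arccos (c r)" if "r \<in> {k - 1..k + 1}"
        using c[OF that] by (auto intro: arccos_lbound)
      show ?thesis
        unfolding * using True r ac F[of r]
        by (auto simp: indicator_def ennreal_mult mult_ac)
    qed (use r k in \<open>auto simp: indicator_def ennreal_neg\<close>)
  qed
  also have "\<dots> = ennreal (2 * pi) * (\<integral>\<^sup>+r. indicator {0..k - 1} r * ennreal (r * F r) \<partial>lborel)
      + 2 * (\<integral>\<^sup>+r. indicator {k - 1..k + 1} r * ennreal (r * F r * arccos (c r)) \<partial>lborel)"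
  proof -
    have "(\<lambda>r. indicator {k - 1..k + 1} r * ennreal (r * F r * arccos (c r)))
        = (\<lambda>r. indicator {k - 1..k + 1} r * ennreal (r * F r * (indicator {k - 1..k + 1} r * arccos (c r))))"
      by (auto simp: fun_eq_iff indicator_def)
    then have [measurable]: "(\<lambda>r. indicator {k - 1..k + 1} r * ennreal (r * F r * arccos (c r)))
        \<in> borel_measurable borel"
      using arccos_meas by simp
    show ?thesis
      by (subst nn_integral_add) (auto simp: nn_integral_cmult)
  qed
  also have "(\<integral>\<^sup>+r. indicator {0..k - 1} r * ennreal (r * F r) \<partial>lborel)
      = ennreal (integral {0..k - 1} (\<lambda>r. r * F r))"
    by (rule nn_integral_Icc_eq_integral(1)[OF meas' bnd'])
  also have "(\<integral>\<^sup>+r. indicator {k - 1..k + 1} r * ennreal (r * F r * arccos (c r)) \<partial>lborel)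
      = ennreal (integral {k - 1..k + 1} (\<lambda>r. r * F r * arccos (c r)))"
    by (rule nn_integral_Icc_eq_integral(1)[OF meas bnd])
  finally have "(\<integral>\<^sup>+z. indicator (cball 0 x) z * ennreal (F (cmod (z - ?t) / y)) \<partial>lborel)
      = ennreal (y\<^sup>2) * (ennreal (2 * pi) * ennreal (integral {0..k - 1} (\<lambda>r. r * F r))
          + 2 * ennreal (integral {k - 1..k + 1} (\<lambda>r. r * F r * arccos (c r))))" .
  also have "\<dots> = ennreal (2 * y\<^sup>2 * (pi * integral {0..k - 1} (\<lambda>r. r * F r)
        + integral {k - 1..k + 1} (\<lambda>r. r * F r * arccos (c r))))"
  proof -
    have two: "(2 :: ennreal) = ennreal 2" by simp
    show ?thesis unfolding two
      using nn_integral_Icc_eq_integral(2)[OF meas bnd]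
        nn_integral_Icc_eq_integral(2)[OF meas' bnd']
      by (simp add: ennreal_mult[symmetric] ennreal_plus[symmetric] algebra_simps
          del: ennreal_plus ennreal_numeral)
  qed
  finally show "(\<integral>\<^sup>+z. indicator (cball 0 x) z * ennreal (F (cmod (z - ?t) / y)) \<partial>lborel) = ennreal ?V"
    by (simp only: k arg c_def)
  have "0 \<le> 2 * y\<^sup>2 * (pi * integral {0..k - 1} (\<lambda>r. r * F r)
        + integral {k - 1..k + 1} (\<lambda>r. r * F r * arccos (c r)))"
    using nn_integral_Icc_eq_integral(2)[OF meas bnd] nn_integral_Icc_eq_integral(2)[OF meas' bnd']
    by simp
  then show "0 \<le> ?V" by (simp only: k arg c_def)
qed (use F in auto)

text \<open>For r > 0 this is 1 / (1 + \<beta> r^(-\<alpha>)), the Laplace transform of a unit-mean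
  exponential at \<beta> r^(-\<alpha>): the factor by which an active interferer at relative
  distance r lowers the success probability.\<close>

definition loss :: "real \<Rightarrow> real \<Rightarrow> real \<Rightarrow> real" where
  "loss \<alpha> \<beta> r = r powr \<alpha> / (\<beta> + r powr \<alpha>)"

lemma borel_measurable_loss [measurable]: "loss \<alpha> \<beta> \<in> borel_measurable borel"
  unfolding loss_def[abs_def] by measurable

lemma loss_bounds:
  assumes "\<beta> > 0"
  shows "0 \<le> loss \<alpha> \<beta> r" "loss \<alpha> \<beta> r \<le> 1"
proof -
  have "0 < \<beta> + r powr \<alpha>" using assms by (intro add_pos_nonneg) auto
  then show "0 \<le> loss \<alpha> \<beta> r" "loss \<alpha> \<beta> r \<le> 1" using assms by (auto simp: loss_def)
qed

section \<open>Closed forms of the disk integrals of the loss factor\<close>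

lemma powr_times_self: "(r::real) \<ge> 0 \<Longrightarrow> r * r powr a = r powr (a + 1)"
  by (cases "r = 0") (auto simp: powr_add)

lemma receiver_eq: "receiver r0 \<theta> j = of_real r0 * cis (if j = 1 then 0 else \<theta>)"
  by (simp add: receiver_def)

text \<open>Dividing numerator and denominator by \<beta> produces the factor 1 / \<beta> in front
  of \<open>Psi\<close>; \<open>calG\<close> and \<open>calZ\<close> are not rescaled in this
  way.\<close>

lemma integral_loss_eq_Psi:
  assumes "\<beta> > 0"
  shows "integral {0..x} (\<lambda>r. r * loss \<alpha> \<beta> r) = Psi \<alpha> \<beta> x / \<beta>"
proof -
  have "integral {0..x} (\<lambda>r. r * loss \<alpha> \<beta> r)
      = integral {0..x} (\<lambda>r. inverse \<beta> * (r powr (\<alpha> + 1) / (1 + r powr \<alpha> * inverse \<beta>)))"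
  proof (rule Henstock_Kurzweil_Integration.integral_cong)
    fix r :: real assume "r \<in> {0..x}"
    then have "r * r powr \<alpha> = r powr (\<alpha> + 1)" by (intro powr_times_self) auto
    moreover have "0 < \<beta> + r powr \<alpha>" using assms by (intro add_pos_nonneg) auto
    ultimately show "r * loss \<alpha> \<beta> r = inverse \<beta> * (r powr (\<alpha> + 1) / (1 + r powr \<alpha> * inverse \<beta>))"
      using assms by (simp add: loss_def field_simps)
  qed
  then show ?thesis by (simp add: Psi_def divide_inverse mult.commute)
qed

lemma times_loss_power:
  assumes "r \<ge> 0"
  shows "r * loss \<alpha> \<beta> r ^ k = r powr (real k * \<alpha> + 1) / (\<beta> + r powr \<alpha>) ^ k"
proof -
  have "r * (r powr \<alpha>) ^ k = r powr (real k * \<alpha> + 1)"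
  proof (cases "r = 0")
    case False
    then show ?thesis using assms by (simp add: powr_add powr_realpow[symmetric] powr_powr mult.commute)
  qed simp
  then show ?thesis by (simp add: loss_def power_divide)
qed

lemma integral_loss_sq_eq_calG: "integral {0..x} (\<lambda>r. r * (loss \<alpha> \<beta> r)\<^sup>2) = calG \<alpha> \<beta> x"
  unfolding calG_def
  by (rule Henstock_Kurzweil_Integration.integral_cong) (simp add: times_loss_power)

lemma integral_loss_eq_calZ:
  assumes "0 < y" "y \<le> x"
  shows "integral {(x - y) / y..(x + y) / y}
      (\<lambda>r. r * loss \<alpha> \<beta> r ^ k * arccos ((y\<^sup>2 * r\<^sup>2 + y\<^sup>2 - x\<^sup>2) / (2 * y\<^sup>2 * r))) = calZ \<alpha> \<beta> k x y"
  unfolding calZ_def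
proof (rule Henstock_Kurzweil_Integration.integral_cong)
  fix r assume r: "r \<in> {(x - y) / y..(x + y) / y}"
  have "0 \<le> (x - y) / y" using assms by simp
  then have "0 \<le> r" using r by (auto intro: order_trans)
  then show "r * loss \<alpha> \<beta> r ^ k * arccos ((y\<^sup>2 * r\<^sup>2 + y\<^sup>2 - x\<^sup>2) / (2 * y\<^sup>2 * r))
      = r powr (real k * \<alpha> + 1) / (\<beta> + r powr \<alpha>) ^ k * arccos ((y\<^sup>2 * r\<^sup>2 + y\<^sup>2 - x\<^sup>2) / (2 * y\<^sup>2 * r))"
    by (simp add: times_loss_power)
qed

text \<open>Both receivers lie on the circle of radius \<open>r0\<close> about the centre of the
  disk, so the value involves neither \<open>j\<close> nor \<open>\<theta>\<close>. This is why both
  have the same mean outage probability.\<close>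

lemma region_integral_loss:
  assumes \<beta>: "\<beta> > 0" and r0: "0 < r0" "r0 \<le> rout"
  shows "(LINT z:network_region rout|lborel. loss \<alpha> \<beta> (cmod (z - receiver r0 \<theta> j) / r0))
    = 2 * r0\<^sup>2 * (pi / \<beta> * Psi \<alpha> \<beta> ((rout - r0) / r0) + calZ \<alpha> \<beta> 1 rout r0)"
  using set_integral_off_centre_disk[of "loss \<alpha> \<beta>" r0 rout "if j = 1 then 0 else \<theta>"]
    integral_loss_eq_calZ[OF r0, of \<alpha> \<beta> 1]
  by (simp add: loss_bounds[OF \<beta>] r0 network_region_def receiver_eq integral_loss_eq_Psi[OF \<beta>])

lemma region_integral_loss_sq:
  assumes \<beta>: "\<beta> > 0" and r0: "0 < r0" "r0 \<le> rout"
  shows "(LINT z:network_region rout|lborel. (loss \<alpha> \<beta> (cmod (z - receiver r0 \<theta> j) / r0))\<^sup>2)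
    = 2 * r0\<^sup>2 * (pi * calG \<alpha> \<beta> ((rout - r0) / r0) + calZ \<alpha> \<beta> 2 rout r0)"
proof -
  have "0 \<le> (loss \<alpha> \<beta> r)\<^sup>2" "(loss \<alpha> \<beta> r)\<^sup>2 \<le> 1" for r
    using loss_bounds[OF \<beta>, of \<alpha> r] by (auto simp: power_le_one)
  then show ?thesis
    using set_integral_off_centre_disk[of "\<lambda>r. (loss \<alpha> \<beta> r)\<^sup>2" r0 rout "if j = 1 then 0 else \<theta>"]
      integral_loss_eq_calZ[OF r0, of \<alpha> \<beta> 2]
    by (simp add: r0 network_region_def receiver_eq integral_loss_sq_eq_calG)
qed

text \<open>The two distances are not both constant on circles around one receiver, so polar
  coordinates are taken around the origin. The factor rout^2 / 2 is the area divided by 2 pi, which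
  matches the normalization of \<open>calX\<close>.\<close>

lemma region_integral_loss_product:
  assumes \<beta>: "\<beta> > 0" and r0: "0 < r0" "r0 \<le> rout"
  shows "(LINT z:network_region rout|lborel. loss \<alpha> \<beta> (cmod (z - receiver r0 \<theta> 1) / r0)
      * loss \<alpha> \<beta> (cmod (z - receiver r0 \<theta> 2) / r0)) = region_area rout * calX \<alpha> \<beta> rout r0 \<theta>"
proof -
  define h where "h z = loss \<alpha> \<beta> (cmod (z - receiver r0 \<theta> 1) / r0)
      * loss \<alpha> \<beta> (cmod (z - receiver r0 \<theta> 2) / r0)" for z
  have [measurable]: "h \<in> borel_measurable borel" unfolding h_def[abs_def] by measurable
  have h: "0 \<le> h z" "h z \<le> 1" for z
    using loss_bounds[OF \<beta>] by (auto simp: h_def intro!: mult_le_one)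
  \<comment> \<open>\<open>polar_dist\<close> adds the disk point to the receiver instead of
    subtracting it; the reflection of the disk in its centre accounts for the sign.\<close>
  have "distr (lborel :: complex measure) borel uminus = lborel"
    using lborel_affine[of "-1" "0::complex"] by (simp add: density_1)
  then have "(LINT z:cball 0 rout|lborel. h z) = (LINT z:cball 0 rout|distr lborel borel uminus. h z)"
    by simp
  also have "\<dots> = (LINT z:cball 0 rout|lborel. h (- z))"
    unfolding set_lebesgue_integral_def
    by (subst integral_distr) (auto simp: indicator_def intro!: Bochner_Integration.integral_cong)
  also have "\<dots> = rout\<^sup>2 / 2 * integral {0..1} (\<lambda>\<rho>. integral {0..2 * pi}
        (\<lambda>t. h (- (of_real (rout * sqrt \<rho>) * cis t))))"
    by (rule set_integral_disk_polar) (use h r0 in auto)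
  also have "(\<lambda>\<rho>. integral {0..2 * pi} (\<lambda>t. h (- (of_real (rout * sqrt \<rho>) * cis t))))
    = (\<lambda>\<rho>. integral {0..2 * pi} (\<lambda>\<phi>.
       polar_dist rout r0 \<rho> \<phi> 0 powr \<alpha> / (\<beta> + polar_dist rout r0 \<rho> \<phi> 0 powr \<alpha>) *
       (polar_dist rout r0 \<rho> \<phi> \<theta> powr \<alpha> / (\<beta> + polar_dist rout r0 \<rho> \<phi> \<theta> powr \<alpha>))))"
  proof -
    have *: "cmod (- (of_real (rout * sqrt \<rho>) * cis t) - receiver r0 \<theta> j) / r0
        = polar_dist rout r0 \<rho> t (if j = 1 then 0 else \<theta>)" for \<rho> t j
    proof -
      have "- (of_real (rout * sqrt \<rho>) * cis t) - receiver r0 \<theta> j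
          = - (of_real r0 * cis (if j = 1 then 0 else \<theta>) + of_real (rout * sqrt \<rho>) * cis t)"
        by (simp add: receiver_eq)
      then show ?thesis unfolding polar_dist_def by (metis norm_minus_cancel)
    qed
    show ?thesis unfolding h_def * loss_def by simp
  qed
  finally show ?thesis
    by (simp add: h_def network_region_def region_area_def calX_def)
qed

section \<open>The generating functional of a Poisson process\<close>

text \<open>The series of s^n against the Poisson weights is that of exp (s m). The value s = 0 is
  included and, by \<open>0 ^ 0 = 1\<close>, gives the probability of having no point; it occurs
  below for the level set 0.\<close>

lemma (in prob_space) poisson_pgf:
  fixes N :: "'a \<Rightarrow> nat"
  assumes N [measurable]: "N \<in> measurable M (count_space UNIV)"
    and pois: "\<And>n. prob {\<omega> \<in> space M. N \<omega> = n} = exp (- m) * m ^ n / fact n"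
    and m: "0 \<le> m" and s: "0 \<le> s" "s \<le> 1"
  shows "expectation (\<lambda>\<omega>. s ^ N \<omega>) = exp (- m * (1 - s))"
proof -
  have "(\<lambda>n. exp (- m) * ((s * m) ^ n /\<^sub>R fact n)) sums (exp (- m) * exp (s * m))"
    by (intro sums_mult exp_converges)
  also have "exp (- m) * exp (s * m) = exp (- m * (1 - s))"
    by (simp add: exp_add[symmetric] algebra_simps)
  also have "(\<lambda>n. exp (- m) * ((s * m) ^ n /\<^sub>R fact n)) = (\<lambda>n. s ^ n * (exp (- m) * m ^ n / fact n))"
    by (simp add: power_mult_distrib divide_inverse mult_ac)
  finally have sums: "(\<lambda>n. s ^ n * (exp (- m) * m ^ n / fact n)) sums exp (- m * (1 - s))" .
  have "(\<integral>\<^sup>+\<omega>. ennreal (s ^ N \<omega>) \<partial>M)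
      = (\<integral>\<^sup>+\<omega>. (\<Sum>n. ennreal (s ^ n) * indicator {\<omega> \<in> space M. N \<omega> = n} \<omega>) \<partial>M)"
  proof (rule nn_integral_cong)
    fix \<omega> assume \<omega>: "\<omega> \<in> space M"
    have "(\<Sum>n. ennreal (s ^ n) * indicator {\<omega> \<in> space M. N \<omega> = n} \<omega>)
        = (\<Sum>n\<in>{N \<omega>}. ennreal (s ^ n) * indicator {\<omega> \<in> space M. N \<omega> = n} \<omega>)"
      by (rule suminf_finite) (auto simp: indicator_def)
    then show "ennreal (s ^ N \<omega>) = (\<Sum>n. ennreal (s ^ n) * indicator {\<omega> \<in> space M. N \<omega> = n} \<omega>)"
      using \<omega> by simp
  qed
  also have "\<dots> = (\<Sum>n. ennreal (s ^ n) * emeasure M {\<omega> \<in> space M. N \<omega> = n})"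
    by (subst nn_integral_suminf) (auto simp: nn_integral_cmult_indicator)
  also have "\<dots> = (\<Sum>n. ennreal (s ^ n * (exp (- m) * m ^ n / fact n)))"
    using m s by (simp add: emeasure_eq_measure pois ennreal_mult[symmetric])
  also have "\<dots> = ennreal (exp (- m * (1 - s)))"
    using m s by (intro suminf_ennreal_eq sums) auto
  finally have "(\<integral>\<^sup>+\<omega>. ennreal (s ^ N \<omega>) \<partial>M) = ennreal (exp (- m * (1 - s)))" .
  then show ?thesis
    using s by (subst integral_eq_nn_integral) auto
qed

lemma nat_floor_approx:
  assumes "0 \<le> (x::real)"
  shows "(\<lambda>n. real (nat \<lfloor>real (Suc n) * x\<rfloor>) / real (Suc n)) \<longlonglongrightarrow> x"
proof (rule tendsto_sandwich)
  have "real (nat \<lfloor>y\<rfloor>) \<le> y" "y - 1 \<le> real (nat \<lfloor>y\<rfloor>)" if "0 \<le> y" for y :: real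
    using that by linarith+
  from this[of "real (Suc n) * x" for n]
  have b: "real (nat \<lfloor>real (Suc n) * x\<rfloor>) \<le> real (Suc n) * x"
    "real (Suc n) * x - 1 \<le> real (nat \<lfloor>real (Suc n) * x\<rfloor>)" for n
    using assms by auto
  show "\<forall>\<^sub>F n in sequentially. x - 1 / real (Suc n) \<le> real (nat \<lfloor>real (Suc n) * x\<rfloor>) / real (Suc n)"
  proof (intro always_eventually allI)
    fix n
    have "(real (Suc n) * x - 1) / real (Suc n) \<le> real (nat \<lfloor>real (Suc n) * x\<rfloor>) / real (Suc n)"
      by (rule divide_right_mono[OF b(2)]) simp
    then show "x - 1 / real (Suc n) \<le> real (nat \<lfloor>real (Suc n) * x\<rfloor>) / real (Suc n)"
      by (simp add: diff_divide_distrib del: of_nat_Suc)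
  qed
  show "\<forall>\<^sub>F n in sequentially. real (nat \<lfloor>real (Suc n) * x\<rfloor>) / real (Suc n) \<le> x"
    using b(1) by (intro always_eventually allI) (simp add: field_simps del: of_nat_Suc)
  show "(\<lambda>n. x - 1 / real (Suc n)) \<longlonglongrightarrow> x"
    by (rule tendsto_eq_rhs[OF tendsto_diff[OF tendsto_const LIMSEQ_Suc[OF lim_1_over_n]]]) simp
qed simp

context prob_space
begin

context
  fixes rate :: real and \<Phi> :: "'a \<Rightarrow> complex set" and A :: "complex set"
  assumes poisson: "homogeneous_poisson_process M rate \<Phi>" and rate: "0 \<le> rate"
    and A [measurable]: "A \<in> sets borel" "bounded A"
begin

lemma poisson_process_finite: "\<omega> \<in> space M \<Longrightarrow> finite (\<Phi> \<omega> \<inter> A)"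
  using poisson A by (auto simp: homogeneous_poisson_process_def)

text \<open>\<open>hn\<close> takes only the values k / n with k \<le> n, so the product over points
  collapses to powers of k / n with the level counts as exponents. The generating functions of the
  independent counts multiply, and their exponents add up to the integral because the level sets
  partition \<open>A\<close>.\<close>

lemma poisson_pgfl_step:
  fixes h :: "complex \<Rightarrow> real" and n :: nat
  assumes [measurable]: "h \<in> borel_measurable borel" and h: "\<And>x. 0 \<le> h x" "\<And>x. h x \<le> 1"
    and n: "n > 0"
  defines "hn \<equiv> \<lambda>x. real (nat \<lfloor>real n * h x\<rfloor>) / real n"
  shows "(\<lambda>\<omega>. \<Prod>x\<in>\<Phi> \<omega> \<inter> A. hn x) \<in> borel_measurable M" (is ?meas)
    and "expectation (\<lambda>\<omega>. \<Prod>x\<in>\<Phi> \<omega> \<inter> A. hn x) = exp (- rate * (LINT x:A|lborel. 1 - hn x))" (is ?int)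
proof -
  define lev where "lev x = nat \<lfloor>real n * h x\<rfloor>" for x
  have lev [measurable]: "lev \<in> measurable borel (count_space UNIV)"
    unfolding lev_def[abs_def] by measurable
  have lev_le: "lev x \<le> n" for x
  proof -
    have "real n * h x \<le> real n * 1" using h by (intro mult_left_mono) auto
    then show ?thesis by (simp add: lev_def nat_le_iff floor_le_iff)
  qed
  define B where "B k = A \<inter> lev -` {k}" for k
  have B: "B k \<in> sets borel" "bounded (B k)" for k
  proof -
    have "lev -` {k} \<in> sets borel"
      using measurable_sets[OF lev, of "{k}"] by simp
    then show "B k \<in> sets borel" using A by (auto simp: B_def)
    show "bounded (B k)" using A by (auto simp: B_def intro: bounded_subset)
  qed
  have disj: "disjoint_family B" by (auto simp: disjoint_family_on_def B_def)
  let ?N = "\<lambda>k \<omega>. card (\<Phi> \<omega> \<inter> B k)"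
  have ind: "indep_vars (\<lambda>_. count_space UNIV) ?N UNIV"
    using poisson B disj by (auto simp: homogeneous_poisson_process_def)
  have N [measurable]: "?N k \<in> measurable M (count_space UNIV)" for k
    using poisson B by (auto simp: homogeneous_poisson_process_def)
  have pois: "prob {\<omega> \<in> space M. ?N k \<omega> = j}
      = exp (- (rate * measure lborel (B k))) * (rate * measure lborel (B k)) ^ j / fact j" for k j
    using poisson B by (auto simp: homogeneous_poisson_process_def)
  have prod_eq: "(\<Prod>x\<in>\<Phi> \<omega> \<inter> A. hn x) = (\<Prod>k\<le>n. (real k / real n) ^ ?N k \<omega>)"
    if "\<omega> \<in> space M" for \<omega>
  proof -
    have "(\<Prod>x\<in>\<Phi> \<omega> \<inter> A. hn x) = (\<Prod>k\<le>n. \<Prod>x\<in>{x \<in> \<Phi> \<omega> \<inter> A. lev x = k}. hn x)"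
      using poisson_process_finite[OF that] lev_le by (intro prod.group[symmetric]) auto
    also have "\<dots> = (\<Prod>k\<le>n. (real k / real n) ^ ?N k \<omega>)"
    proof (rule prod.cong[OF refl])
      fix k
      have "{x \<in> \<Phi> \<omega> \<inter> A. lev x = k} = \<Phi> \<omega> \<inter> B k" by (auto simp: B_def)
      moreover have "(\<Prod>x\<in>\<Phi> \<omega> \<inter> B k. hn x) = (\<Prod>x\<in>\<Phi> \<omega> \<inter> B k. real k / real n)"
        by (rule prod.cong) (auto simp: B_def hn_def lev_def)
      ultimately show "(\<Prod>x\<in>{x \<in> \<Phi> \<omega> \<inter> A. lev x = k}. hn x) = (real k / real n) ^ ?N k \<omega>"
        by simp
    qed
    finally show ?thesis .
  qed
  have "(\<lambda>\<omega>. \<Prod>k\<le>n. (real k / real n) ^ ?N k \<omega>) \<in> borel_measurable M" by measurable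
  then show ?meas by (simp cong: measurable_cong add: prod_eq)
  have "expectation (\<lambda>\<omega>. \<Prod>x\<in>\<Phi> \<omega> \<inter> A. hn x) = expectation (\<lambda>\<omega>. \<Prod>k\<le>n. (real k / real n) ^ ?N k \<omega>)"
    by (rule Bochner_Integration.integral_cong) (auto simp: prod_eq)
  also have "\<dots> = (\<Prod>k\<le>n. expectation (\<lambda>\<omega>. (real k / real n) ^ ?N k \<omega>))"
  proof (rule indep_vars_lebesgue_integral)
    show "indep_vars (\<lambda>_. borel) (\<lambda>k \<omega>. (real k / real n) ^ ?N k \<omega>) {..n}"
      by (rule indep_vars_compose2[OF indep_vars_subset[OF ind]]) auto
    show "integrable M (\<lambda>\<omega>. (real k / real n) ^ ?N k \<omega>)" if "k \<in> {..n}" for k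
    proof (rule integrable_const_bound[where B = 1])
      have "(real k / real n) ^ j \<le> 1" for j
        using that n by (intro power_le_one) (auto simp: divide_le_eq)
      then show "AE \<omega> in M. norm ((real k / real n) ^ ?N k \<omega>) \<le> 1" by simp
    qed measurable
  qed simp
  also have "\<dots> = (\<Prod>k\<le>n. exp (- (rate * measure lborel (B k)) * (1 - real k / real n)))"
    by (intro prod.cong refl poisson_pgf pois) (use rate n in auto)
  also have "\<dots> = exp (- rate * (\<Sum>k\<le>n. measure lborel (B k) * (1 - real k / real n)))"
    by (simp add: exp_sum sum_distrib_left mult.assoc sum_negf[symmetric])
  also have "(\<Sum>k\<le>n. measure lborel (B k) * (1 - real k / real n)) = (LINT x:A|lborel. 1 - hn x)"
  proof -
    have fin: "emeasure lborel (B k) < \<infinity>" for k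
      using emeasure_bounded_finite[OF B(2)] by simp
    have "(LINT x:A|lborel. 1 - hn x)
        = (LINT x|lborel. (\<Sum>k\<le>n. indicator (B k) x *\<^sub>R (1 - real k / real n)))"
      unfolding set_lebesgue_integral_def
    proof (rule Bochner_Integration.integral_cong[OF refl])
      fix x
      have "(\<Sum>k\<le>n. indicator (B k) x *\<^sub>R (1 - real k / real n))
          = (\<Sum>k\<le>n. if k = lev x then indicator A x *\<^sub>R (1 - real k / real n) else 0)"
        by (intro sum.cong) (auto simp: B_def indicator_def)
      then show "indicator A x *\<^sub>R (1 - hn x) = (\<Sum>k\<le>n. indicator (B k) x *\<^sub>R (1 - real k / real n))"
        using lev_le[of x] by (simp add: hn_def lev_def)
    qed
    also have "\<dots> = (\<Sum>k\<le>n. LINT x|lborel. indicator (B k) x *\<^sub>R (1 - real k / real n))"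
      using B fin by (intro Bochner_Integration.integral_sum integrable_scaleR_left integrable_real_indicator) auto
    also have "\<dots> = (\<Sum>k\<le>n. measure lborel (B k) * (1 - real k / real n))"
      using B by simp
    finally show ?thesis by simp
  qed
  finally show ?int .
qed

text \<open>Dominated convergence on both sides of the identity for the discretized functions: the
  products are bounded by 1 on a probability space, and the integrands in the exponents by the
  indicator of \<open>A\<close>, which is integrable because \<open>A\<close> is bounded.\<close>

theorem poisson_generating_functional:
  fixes h :: "complex \<Rightarrow> real"
  assumes [measurable]: "h \<in> borel_measurable borel" and h: "\<And>x. 0 \<le> h x" "\<And>x. h x \<le> 1"
  shows "(\<lambda>\<omega>. \<Prod>x\<in>\<Phi> \<omega> \<inter> A. h x) \<in> borel_measurable M"
    and "expectation (\<lambda>\<omega>. \<Prod>x\<in>\<Phi> \<omega> \<inter> A. h x) = exp (- rate * (LINT x:A|lborel. 1 - h x))"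
proof -
  define hn where "hn n x = real (nat \<lfloor>real (Suc n) * h x\<rfloor>) / real (Suc n)" for n x
  have lim: "(\<lambda>n. hn n x) \<longlonglongrightarrow> h x" for x
    unfolding hn_def by (rule nat_floor_approx) (rule h)
  have hn_meas [measurable]: "hn n \<in> borel_measurable borel" for n
    unfolding hn_def by measurable
  have hn: "0 \<le> hn n x" "hn n x \<le> 1" for n x
  proof -
    have "real (Suc n) * h x \<le> real (Suc n) * 1" using h by (intro mult_left_mono) auto
    then have "real (nat \<lfloor>real (Suc n) * h x\<rfloor>) \<le> real (Suc n)"
      by (simp only: of_nat_le_iff nat_le_iff floor_le_iff mult_1_right of_int_of_nat_eq)
    then show "0 \<le> hn n x" "hn n x \<le> 1" by (auto simp: hn_def)
  qed
  note step = poisson_pgfl_step[OF assms zero_less_Suc, folded hn_def]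
  have plim: "(\<lambda>n. \<Prod>x\<in>\<Phi> \<omega> \<inter> A. hn n x) \<longlonglongrightarrow> (\<Prod>x\<in>\<Phi> \<omega> \<inter> A. h x)" for \<omega>
    by (intro tendsto_prod lim)
  show meas: "(\<lambda>\<omega>. \<Prod>x\<in>\<Phi> \<omega> \<inter> A. h x) \<in> borel_measurable M"
    by (rule borel_measurable_LIMSEQ_real[OF plim step(1)])
  have "(\<lambda>n. expectation (\<lambda>\<omega>. \<Prod>x\<in>\<Phi> \<omega> \<inter> A. hn n x)) \<longlonglongrightarrow> expectation (\<lambda>\<omega>. \<Prod>x\<in>\<Phi> \<omega> \<inter> A. h x)"
  proof (rule integral_dominated_convergence[where w = "\<lambda>_. 1"])
    show "AE \<omega> in M. norm (\<Prod>x\<in>\<Phi> \<omega> \<inter> A. hn n x) \<le> 1" for n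
      using hn by (intro AE_I2) (auto simp: abs_prod intro!: prod_le_1)
  qed (use plim meas step in auto)
  moreover have "(\<lambda>n. exp (- rate * (LINT x:A|lborel. 1 - hn n x)))
      \<longlonglongrightarrow> exp (- rate * (LINT x:A|lborel. 1 - h x))"
    unfolding set_lebesgue_integral_def
  proof (intro tendsto_exp tendsto_mult tendsto_const
      integral_dominated_convergence[where w = "indicator A"])
    show "integrable lborel (indicator A :: complex \<Rightarrow> real)"
      using emeasure_bounded_finite[OF A(2)] A by (intro integrable_real_indicator) auto
    show "AE x in lborel. (\<lambda>n. indicator A x *\<^sub>R (1 - hn n x)) \<longlonglongrightarrow> indicator A x *\<^sub>R (1 - h x)"
      by (intro AE_I2 tendsto_intros lim)
    show "AE x in lborel. norm (indicator A x *\<^sub>R (1 - hn n x)) \<le> indicator A x" for n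
      using hn by (intro AE_I2) (auto simp: indicator_def)
  qed (use A in measurable)
  ultimately show "expectation (\<lambda>\<omega>. \<Prod>x\<in>\<Phi> \<omega> \<inter> A. h x) = exp (- rate * (LINT x:A|lborel. 1 - h x))"
    unfolding step(2) by (rule LIMSEQ_unique)
qed

end

end

section \<open>Outage under Rayleigh fading\<close>

context prob_space
begin

text \<open>Independence of the two families of preimages says that the joint law is the product of
  the laws of \<open>X\<close> and \<open>Y\<close>; Fubini then lets \<open>X\<close> be frozen
  while \<open>Y\<close> is averaged. Preimage families are used because the model states its
  independence for sigma-algebras.\<close>

lemma indep_set_freeze:
  fixes f :: "'b \<times> 'c \<Rightarrow> real"
  assumes X [measurable]: "X \<in> measurable M S" and Y [measurable]: "Y \<in> measurable M T"
    and ind: "indep_set {X -` A \<inter> space M | A. A \<in> sets S} {Y -` A \<inter> space M | A. A \<in> sets T}"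
    and f [measurable]: "f \<in> borel_measurable (S \<Otimes>\<^sub>M T)"
    and bnd: "\<And>z. \<bar>f z\<bar> \<le> B"
  shows "expectation (\<lambda>\<omega>. f (X \<omega>, Y \<omega>)) = expectation (\<lambda>\<omega>. expectation (\<lambda>\<omega>'. f (X \<omega>, Y \<omega>')))"
proof -
  interpret X: prob_space "distr M S X" by (rule prob_space_distr) measurable
  interpret Y: prob_space "distr M T Y" by (rule prob_space_distr) measurable
  interpret XY: pair_prob_space "distr M S X" "distr M T Y" ..
  have eq: "distr M S X \<Otimes>\<^sub>M distr M T Y = distr M (S \<Otimes>\<^sub>M T) (\<lambda>x. (X x, Y x))"
  proof (rule pair_measure_eqI)
    fix A B assume "A \<in> sets (distr M S X)" "B \<in> sets (distr M T Y)"
    then have AB [measurable]: "A \<in> sets S" "B \<in> sets T" by auto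
    have "prob ((X -` A \<inter> space M) \<inter> (Y -` B \<inter> space M)) = prob (X -` A \<inter> space M) * prob (Y -` B \<inter> space M)"
      using ind AB unfolding indep_sets2_eq by blast
    moreover have "(\<lambda>x. (X x, Y x)) -` (A \<times> B) \<inter> space M = (X -` A \<inter> space M) \<inter> (Y -` B \<inter> space M)"
      by auto
    ultimately show "emeasure (distr M S X) A * emeasure (distr M T Y) B
        = emeasure (distr M (S \<Otimes>\<^sub>M T) (\<lambda>x. (X x, Y x))) (A \<times> B)"
      using AB by (simp add: emeasure_distr emeasure_eq_measure ennreal_mult)
  qed (auto intro: X.sigma_finite_measure_axioms Y.sigma_finite_measure_axioms)
  have "expectation (\<lambda>\<omega>. f (X \<omega>, Y \<omega>)) = (LINT z|(distr M S X \<Otimes>\<^sub>M distr M T Y). f z)"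
    by (simp add: eq integral_distr)
  also have "\<dots> = (LINT x|distr M S X. LINT y|distr M T Y. f (x, y))"
    by (rule XY.integral_fst'[symmetric], rule XY.P.integrable_const_bound[where B = B]) (auto simp: bnd)
  also have "\<dots> = (LINT x|distr M S X. expectation (\<lambda>\<omega>'. f (x, Y \<omega>')))"
    by (rule Bochner_Integration.integral_cong) (auto intro!: integral_distr)
  also have "\<dots> = expectation (\<lambda>\<omega>. expectation (\<lambda>\<omega>'. f (X \<omega>, Y \<omega>')))"
    by (rule integral_distr) auto
  finally show ?thesis .
qed

text \<open>The roles are exchanged so that the second variable becomes the one to be
  frozen.\<close>

lemma indep_var_imp_indep_set:
  assumes ind: "indep_var S X T Y"
  shows "indep_set {Y -` B \<inter> space M | B. B \<in> sets T} {X -` A \<inter> space M | A. A \<in> sets S}"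
proof -
  have X: "X \<in> measurable M S" and Y: "Y \<in> measurable M T"
    using ind by (blast dest: indep_var_rv1 indep_var_rv2)+
  have "prob ((Y -` B \<inter> space M) \<inter> (X -` A \<inter> space M)) = prob (Y -` B \<inter> space M) * prob (X -` A \<inter> space M)"
    if "A \<in> sets S" "B \<in> sets T" for A B
  proof -
    have "(Y -` B \<inter> space M) \<inter> (X -` A \<inter> space M) = (\<lambda>x. (X x, Y x)) -` (A \<times> B) \<inter> space M"
      by auto
    then show ?thesis using indep_varD[OF ind that] by (simp add: mult.commute)
  qed
  then show ?thesis
    using measurable_sets[OF X] measurable_sets[OF Y] unfolding indep_sets2_eq by auto
qed

text \<open>Tilting by exp (-t x) turns the density of rate 1 into 1 / (1 + t) times the density of
  rate 1 + t, whose total mass is 1.\<close>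

lemma exponential_laplace:
  assumes D: "distributed M lborel G (exponential_density 1)" and t: "0 \<le> t"
  shows "expectation (\<lambda>\<omega>. exp (- t * G \<omega>)) = 1 / (1 + t)"
proof -
  interpret E: prob_space "density lborel (exponential_density (1 + t))"
    using t by (intro prob_space_exponential_density) auto
  have nonneg: "0 \<le> exponential_density (1 + t) x" for x
    using t by (simp add: exponential_density_def)
  have "(LINT x|lborel. exponential_density (1 + t) x)
      = (LINT x|density lborel (exponential_density (1 + t)). 1)"
    using nonneg by (subst integral_density) auto
  then have one: "(LINT x|lborel. exponential_density (1 + t) x) = 1"
    using E.prob_space by simp
  have "expectation (\<lambda>\<omega>. exp (- t * G \<omega>)) = (LINT x|lborel. exponential_density 1 x * exp (- t * x))"
    by (rule distributed_integral[OF D, symmetric]) (auto simp: exponential_density_def)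
  also have "\<dots> = (LINT x|lborel. (1 / (1 + t)) * exponential_density (1 + t) x)"
    using t by (intro Bochner_Integration.integral_cong)
       (auto simp: exponential_density_def exp_add[symmetric] nonzero_eq_divide_eq algebra_simps)
  finally show ?thesis by (simp add: one)
qed

lemma exponential_AE_nonneg:
  assumes D: "distributed M lborel G (exponential_density 1)"
  shows "AE \<omega> in M. 0 \<le> G \<omega>"
proof -
  have [measurable]: "G \<in> borel_measurable M" using distributed_measurable[OF D] by simp
  have "prob {\<omega> \<in> space M. G \<omega> \<le> 0} = 0"
    using exponential_distributedD_le[OF D, of 0] by simp
  then have "AE \<omega> in M. \<not> G \<omega> \<le> 0"
    by (intro AE_I[where N = "{\<omega> \<in> space M. G \<omega> \<le> 0}"]) (auto simp: emeasure_eq_measure)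
  then show ?thesis by eventually_elim auto
qed

text \<open>The signal gain \<open>G 0\<close> is integrated out first, against the frozen interference; what is left
  is the Laplace transform of the interference.\<close>

lemma rayleigh_outage:
  fixes G :: "nat \<Rightarrow> 'a \<Rightarrow> real" and c :: "nat \<Rightarrow> real"
  assumes ind: "indep_vars (\<lambda>_. borel) G {..m}"
    and D: "\<And>i. i \<le> m \<Longrightarrow> distributed M lborel (G i) (exponential_density 1)"
    and c: "\<And>i. 0 \<le> c i" and s: "0 < s" and b: "0 < b"
  shows "expectation (\<lambda>\<omega>. of_bool (G 0 \<omega> / (s + (\<Sum>i=1..m. c i * G i \<omega>)) \<le> b))
    = 1 - exp (- b * s) * (\<Prod>i=1..m. 1 / (1 + b * c i))"
proof -
  have G [measurable]: "G i \<in> borel_measurable M" if "i \<le> m" for i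
    using ind that by (auto simp: indep_vars_def)
  define T where "T \<omega> = (\<Sum>i=1..m. c i * G i \<omega>)" for \<omega>
  have T [measurable]: "T \<in> borel_measurable M"
    unfolding T_def[abs_def] by measurable
  have "insert 0 {1..m} = {..m}" by auto
  \<comment> \<open>Index 0, the signal, stays unscaled while the others carry their weights;
    splitting one index off a sum of independent variables then separates signal and
    interference.\<close>
  then have ind': "indep_vars (\<lambda>_. borel) (\<lambda>i \<omega>. if i = 0 then G 0 \<omega> else c i * G i \<omega>) (insert 0 {1..m})"
    using indep_vars_compose2[OF ind, of "\<lambda>i x. if i = 0 then x else c i * x" "\<lambda>_. borel"]
    by (simp cong: if_cong)
  have "indep_var borel (G 0) borel (\<lambda>\<omega>. \<Sum>i=1..m. if i = 0 then G 0 \<omega> else c i * G i \<omega>)"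
    using indep_vars_sum[OF _ _ ind'] by simp
  also have "(\<lambda>\<omega>. \<Sum>i=1..m. if i = 0 then G 0 \<omega> else c i * G i \<omega>) = T"
    by (auto simp: T_def fun_eq_iff intro!: sum.cong)
  finally have indT: "indep_set {T -` A \<inter> space M | A. A \<in> sets borel} {G 0 -` A \<inter> space M | A. A \<in> sets borel}"
    by (rule indep_var_imp_indep_set)
  \<comment> \<open>Nonnegative gains keep the denominator at least s > 0, so that the quotient
    condition becomes G 0 \<le> b (s + T); they also bound the exponentials by 1.\<close>
  have G_nonneg: "AE \<omega> in M. \<forall>i\<in>{..m}. 0 \<le> G i \<omega>"
    by (rule AE_finite_allI) (use exponential_AE_nonneg[OF D] in auto)
  then have T_nonneg: "AE \<omega> in M. 0 \<le> T \<omega>"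
    by eventually_elim (auto simp: T_def intro!: sum_nonneg mult_nonneg_nonneg c)
  have "expectation (\<lambda>\<omega>. of_bool (G 0 \<omega> / (s + T \<omega>) \<le> b) :: real)
      = expectation (\<lambda>\<omega>. expectation (\<lambda>\<omega>'. of_bool (G 0 \<omega>' / (s + T \<omega>) \<le> b)))"
    using indep_set_freeze[OF T G[of 0] indT, of "\<lambda>z. of_bool (snd z / (s + fst z) \<le> b)" 1] by simp
  also have "\<dots> = expectation (\<lambda>\<omega>. 1 - exp (- b * s) * (\<Prod>i=1..m. exp (- (b * c i) * G i \<omega>)))"
  proof (rule integral_cong_AE)
    show "AE \<omega> in M. expectation (\<lambda>\<omega>'. of_bool (G 0 \<omega>' / (s + T \<omega>) \<le> b))
        = 1 - exp (- b * s) * (\<Prod>i=1..m. exp (- (b * c i) * G i \<omega>))"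
      using T_nonneg
    proof eventually_elim
      case (elim \<omega>)
      then have pos: "0 < s + T \<omega>" using s by simp
      have "expectation (\<lambda>\<omega>'. of_bool (G 0 \<omega>' / (s + T \<omega>) \<le> b))
          = expectation (indicator {\<omega>' \<in> space M. G 0 \<omega>' \<le> b * (s + T \<omega>)})"
        using pos by (intro Bochner_Integration.integral_cong) (auto simp: indicator_def pos_divide_le_eq)
      also have "\<dots> = prob {\<omega>' \<in> space M. G 0 \<omega>' \<le> b * (s + T \<omega>)}" by simp
      also have "\<dots> = 1 - exp (- (b * (s + T \<omega>)))"
        using exponential_distributedD_le[OF D[of 0], of "b * (s + T \<omega>)"] pos b by simp
      also have "exp (- (b * (s + T \<omega>))) = exp (- b * s) * (\<Prod>i=1..m. exp (- (b * c i) * G i \<omega>))"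
        by (simp add: exp_sum[symmetric] exp_add[symmetric] T_def distrib_left sum_distrib_left
            sum_negf mult.assoc)
      finally show ?case .
    qed
  qed measurable
  also have "\<dots> = 1 - exp (- b * s) * expectation (\<lambda>\<omega>. \<Prod>i=1..m. exp (- (b * c i) * G i \<omega>))"
  proof -
    have "AE \<omega> in M. norm (\<Prod>i=1..m. exp (- (b * c i) * G i \<omega>)) \<le> 1"
      using G_nonneg by eventually_elim (auto simp: abs_prod c b less_imp_le intro!: prod_le_1)
    then have "integrable M (\<lambda>\<omega>. \<Prod>i=1..m. exp (- (b * c i) * G i \<omega>))"
      by (rule integrable_const_bound) measurable
    then show ?thesis by (simp add: prob_space)
  qed
  also have "expectation (\<lambda>\<omega>. \<Prod>i=1..m. exp (- (b * c i) * G i \<omega>))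
      = (\<Prod>i=1..m. expectation (\<lambda>\<omega>. exp (- (b * c i) * G i \<omega>)))"
  proof (rule indep_vars_lebesgue_integral)
    show "indep_vars (\<lambda>_. borel) (\<lambda>i \<omega>. exp (- (b * c i) * G i \<omega>)) {1..m}"
      by (rule indep_vars_compose2[OF indep_vars_subset[OF ind]]) auto
    show "integrable M (\<lambda>\<omega>. exp (- (b * c i) * G i \<omega>))" if "i \<in> {1..m}" for i
    proof (rule integrable_const_bound)
      have [measurable]: "G i \<in> borel_measurable M" using that by (intro G) simp
      show "(\<lambda>\<omega>. exp (- (b * c i) * G i \<omega>)) \<in> borel_measurable M" by measurable
      show "AE \<omega> in M. norm (exp (- (b * c i) * G i \<omega>)) \<le> 1"
        using G_nonneg by eventually_elim (use that c b in \<open>auto simp: less_imp_le\<close>)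
    qed
  qed simp
  also have "\<dots> = (\<Prod>i=1..m. 1 / (1 + b * c i))"
    by (intro prod.cong refl exponential_laplace D) (use b c in \<open>auto simp: less_imp_le\<close>)
  finally show ?thesis by (simp add: T_def)
qed

end

section \<open>The network model and its three independent sources of randomness\<close>

locale rayleigh_network = prob_space \<Omega> for \<Omega> :: "'w measure" +
  fixes \<Phi> :: "'w \<Rightarrow> complex set"
    and M :: "'w \<Rightarrow> nat"
    and X :: "nat \<Rightarrow> 'w \<Rightarrow> complex"
    and I :: "nat \<Rightarrow> 'w \<Rightarrow> bool"
    and g :: "nat \<Rightarrow> nat \<Rightarrow> 'w \<Rightarrow> real"
    and \<alpha> \<beta> SNR rate p rout r0 \<theta> :: real
  assumes \<beta>: "\<beta> > 0" and SNR: "SNR > 0" and rate: "rate > 0"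
    and p: "0 \<le> p" "p \<le> 1"
    and r0: "0 < r0" "r0 \<le> rout"
    and poisson: "homogeneous_poisson_process \<Omega> rate \<Phi>"
    and interferers: "\<forall>\<omega>\<in>space \<Omega>. bij_betw (\<lambda>i. X i \<omega>) {1..M \<omega>} (\<Phi> \<omega> \<inter> network_region rout)"
    and gains_indep: "indep_vars (\<lambda>_. borel) (\<lambda>(i, j). g i j) (UNIV \<times> {1, 2})"
    and gains_exponential:
      "\<forall>i. \<forall>j\<in>{1, 2}. distributed \<Omega> lborel (g i j) (exponential_density 1)"
    and activities_indep: "indep_vars (\<lambda>_. count_space UNIV) I {1..}"
    and activities_bernoulli:
      "\<forall>i\<ge>1. distr \<Omega> (count_space UNIV) (I i) = measure_pmf (bernoulli_pmf p)"
    and mutually_indep: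
      "indep_sets
         (\<lambda>k. [sets (sigma_gains \<Omega> g), sets (sigma_activities \<Omega> I), sets (sigma_positions \<Omega> M X)] ! k)
         {0, 1, 2}"
begin

abbreviation gains_space :: "(nat \<times> nat \<Rightarrow> real) measure" where
  "gains_space \<equiv> PiM (UNIV \<times> {1, 2}) (\<lambda>_. borel)"

abbreviation activities_space :: "(nat \<Rightarrow> bool) measure" where
  "activities_space \<equiv> PiM {1..} (\<lambda>_. count_space UNIV)"

abbreviation positions_space :: "(nat \<times> (nat \<Rightarrow> complex)) measure" where
  "positions_space \<equiv> count_space UNIV \<Otimes>\<^sub>M PiM UNIV (\<lambda>_. borel)"

abbreviation distances_space :: "(nat \<times> (nat \<times> nat \<Rightarrow> real)) measure" where
  "distances_space \<equiv> count_space UNIV \<Otimes>\<^sub>M PiM (UNIV \<times> {1, 2}) (\<lambda>_. borel)"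

definition gains :: "'w \<Rightarrow> nat \<times> nat \<Rightarrow> real" where
  "gains \<omega> = (\<lambda>(i, j)\<in>UNIV \<times> {1, 2}. g i j \<omega>)"

definition activities :: "'w \<Rightarrow> nat \<Rightarrow> bool" where
  "activities \<omega> = (\<lambda>i\<in>{1..}. I i \<omega>)"

lemma gains_space: "gains \<omega> \<in> space gains_space"
  by (auto simp: gains_def space_PiM)

lemma activities_space: "activities \<omega> \<in> space activities_space"
  by (auto simp: activities_def space_PiM)

lemma positions_space: "positions M X \<omega> \<in> space positions_space"
  by (auto simp: positions_def space_PiM space_pair_measure)

lemma sets_sigma_gains: "sets (sigma_gains \<Omega> g) = {gains -` A \<inter> space \<Omega> | A. A \<in> sets gains_space}"
  unfolding sigma_gains_def gains_def[abs_def, symmetric]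
  by (rule sets_vimage_algebra2) (use gains_space in auto)

lemma sets_sigma_activities:
  "sets (sigma_activities \<Omega> I) = {activities -` A \<inter> space \<Omega> | A. A \<in> sets activities_space}"
  unfolding sigma_activities_def activities_def[abs_def, symmetric]
  by (rule sets_vimage_algebra2) (use activities_space in auto)

lemma sets_sigma_positions:
  "sets (sigma_positions \<Omega> M X) = {positions M X -` A \<inter> space \<Omega> | A. A \<in> sets positions_space}"
  unfolding sigma_positions_def
  by (rule sets_vimage_algebra2) (use positions_space in auto)

text \<open>\<open>indep_sets\<close> includes that its families consist of events. Measurability of
  \<open>positions M X\<close> comes from here: the \<open>X i\<close> carry no measurability
  hypothesis of their own.\<close>

lemma sigma_events:
  "sets (sigma_gains \<Omega> g) \<subseteq> events" "sets (sigma_activities \<Omega> I) \<subseteq> events"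
  "sets (sigma_positions \<Omega> M X) \<subseteq> events"
  using mutually_indep by (auto simp: indep_sets_def)

lemma measurable_gains [measurable]: "gains \<in> measurable \<Omega> gains_space"
  using sigma_events(1) gains_space by (intro measurableI) (auto simp: sets_sigma_gains)

lemma measurable_activities [measurable]: "activities \<in> measurable \<Omega> activities_space"
  using sigma_events(2) activities_space by (intro measurableI) (auto simp: sets_sigma_activities)

lemma measurable_positions [measurable]: "positions M X \<in> measurable \<Omega> positions_space"
  using sigma_events(3) positions_space by (intro measurableI) (auto simp: sets_sigma_positions)

lemma indep_activities_gains:
  "indep_set {activities -` A \<inter> space \<Omega> | A. A \<in> sets activities_space}
     {gains -` A \<inter> space \<Omega> | A. A \<in> sets gains_space}"
  unfolding sets_sigma_gains[symmetric] sets_sigma_activities[symmetric] indep_sets2_eq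
proof (intro conjI ballI sigma_events)
  fix a b assume ab: "a \<in> sets (sigma_activities \<Omega> I)" "b \<in> sets (sigma_gains \<Omega> g)"
  have "prob (\<Inter>k\<in>{0, 1::nat}. if k = 0 then b else a) = (\<Prod>k\<in>{0, 1::nat}. prob (if k = 0 then b else a))"
    by (rule indep_setsD[OF mutually_indep, where J = "{0, 1}" and A = "\<lambda>k. if k = 0 then b else a"])
       (use ab in auto)
  then show "prob (a \<inter> b) = prob a * prob b" by (simp add: Int_commute mult.commute)
qed

text \<open>Threefold independence is regrouped as positions against the pair of activities and
  gains. Disjoint groups of intersection-stable independent families generate independent
  sigma-algebras, and a preimage under the pair lies in the one generated by activities and gains
  together.\<close>

lemma indep_positions_rest:
  "indep_set {positions M X -` A \<inter> space \<Omega> | A. A \<in> sets positions_space}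
     {(\<lambda>\<omega>. (activities \<omega>, gains \<omega>)) -` A \<inter> space \<Omega> | A. A \<in> sets (activities_space \<Otimes>\<^sub>M gains_space)}"
proof -
  let ?F = "\<lambda>k. [sets (sigma_gains \<Omega> g), sets (sigma_activities \<Omega> I), sets (sigma_positions \<Omega> M X)] ! k"
  let ?K = "\<lambda>b. if b then {2} else {0, 1 :: nat}"
  have "indep_sets (\<lambda>b. sigma_sets (space \<Omega>) (\<Union>i\<in>?K b. ?F i)) UNIV"
  proof (rule indep_sets_collect_sigma)
    have "(\<Union>b. ?K b) = {0, 1, 2}" by (auto simp: UNIV_bool)
    then show "indep_sets ?F (\<Union>b. ?K b)" using mutually_indep by simp
    show "Int_stable (?F i)" if "i \<in> ?K b" for i b
      using that by (auto simp: Int_stable_def split: if_splits)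
  qed (auto simp: disjoint_family_on_def split: if_splits)
  note ind = this
  let ?N = "sigma (space \<Omega>) (sets (sigma_activities \<Omega> I) \<union> sets (sigma_gains \<Omega> g))"
  have sub: "sets (sigma_activities \<Omega> I) \<union> sets (sigma_gains \<Omega> g) \<subseteq> Pow (space \<Omega>)"
    using sigma_events sets.space_closed by blast
  have "activities -` A \<inter> space \<Omega> \<in> sets ?N" if "A \<in> sets activities_space" for A
  proof -
    have "activities -` A \<inter> space \<Omega> \<in> sets (sigma_activities \<Omega> I)"
      using that unfolding sets_sigma_activities by blast
    then show ?thesis using sub by simp
  qed
  moreover have "gains -` A \<inter> space \<Omega> \<in> sets ?N" if "A \<in> sets gains_space" for A
  proof -
    have "gains -` A \<inter> space \<Omega> \<in> sets (sigma_gains \<Omega> g)"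
      using that unfolding sets_sigma_gains by blast
    then show ?thesis using sub by simp
  qed
  moreover have "space ?N = space \<Omega>" using sub by (simp add: space_measure_of_conv)
  ultimately have "activities \<in> measurable ?N activities_space" "gains \<in> measurable ?N gains_space"
    using activities_space gains_space by (auto simp: measurable_def)
  then have pair: "(\<lambda>\<omega>. (activities \<omega>, gains \<omega>)) \<in> measurable ?N (activities_space \<Otimes>\<^sub>M gains_space)"
    by measurable
  have "prob (a \<inter> b) = prob a * prob b"
    if a: "a \<in> sets (sigma_positions \<Omega> M X)"
      and b: "b \<in> {(\<lambda>\<omega>. (activities \<omega>, gains \<omega>)) -` A \<inter> space \<Omega> | A. A \<in> sets (activities_space \<Otimes>\<^sub>M gains_space)}"
    for a b
  proof -
    have "b \<in> sets ?N" using b measurable_sets[OF pair] sub by (auto simp: space_measure_of_conv)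
    then have "b \<in> sigma_sets (space \<Omega>) (\<Union>i\<in>?K False. ?F i)"
      using sub by (simp add: Un_commute)
    moreover have "a \<in> sigma_sets (space \<Omega>) (\<Union>i\<in>?K True. ?F i)"
      using a by auto
    ultimately have "prob (\<Inter>k\<in>UNIV. if k then a else b) = (\<Prod>k\<in>UNIV. prob (if k then a else b))"
      by (intro indep_setsD[OF ind, where J = UNIV and A = "\<lambda>k. if k then a else b"]) auto
    then show ?thesis by (simp add: UNIV_bool Int_commute mult.commute)
  qed
  moreover have "{(\<lambda>\<omega>. (activities \<omega>, gains \<omega>)) -` A \<inter> space \<Omega> | A.
      A \<in> sets (activities_space \<Otimes>\<^sub>M gains_space)} \<subseteq> events"
  proof -
    have "(\<lambda>\<omega>. (activities \<omega>, gains \<omega>)) \<in> measurable \<Omega> (activities_space \<Otimes>\<^sub>M gains_space)"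
      by measurable
    from measurable_sets[OF this] show ?thesis by auto
  qed
  ultimately show ?thesis
    unfolding indep_sets2_eq sets_sigma_positions[symmetric]
    by (intro conjI ballI sigma_events(3))
qed

lemma measurable_of_bool_activity:
  assumes "i \<ge> 1"
  shows "(\<lambda>a. of_bool (a i) :: real) \<in> borel_measurable activities_space"
proof -
  have "(\<lambda>a. a i) \<in> measurable activities_space (count_space UNIV)"
    by (rule measurable_component_singleton) (use assms in simp)
  then show ?thesis by (rule measurable_compose) simp
qed

lemma measurable_gain:
  assumes "j \<in> {1, 2}"
  shows "(\<lambda>v. v (i, j)) \<in> borel_measurable gains_space"
  by (rule measurable_component_singleton) (use assms in simp)

lemma conditional_outage:
  fixes w :: "nat \<Rightarrow> real"
  assumes j: "j \<in> {1, 2}" and w: "\<And>i. 0 \<le> w i"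
  shows "expectation (\<lambda>\<omega>. of_bool
      (g 0 j \<omega> / (inverse SNR + (\<Sum>i=1..m. of_bool (I i \<omega>) * g i j \<omega> * w i)) \<le> \<beta>))
    = 1 - exp (- (\<beta> / SNR)) * (\<Prod>i=1..m. 1 - p + p / (1 + \<beta> * w i))"
proof -
  let ?out = "\<lambda>a v. of_bool (v (0, j) / (inverse SNR + (\<Sum>i=1..m. of_bool (a i) * v (i, j) * w i)) \<le> \<beta>) :: real"
  have val: "gains \<omega> (i, j) = g i j \<omega>" for i \<omega>
    using j by (auto simp: gains_def)
  have act: "(\<Sum>i=1..m. of_bool (activities \<omega> i) * g i j \<omega>' * w i)
      = (\<Sum>i=1..m. (of_bool (I i \<omega>) * w i) * g i j \<omega>')" for \<omega> \<omega>'
    by (intro sum.cong) (auto simp: activities_def)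
  have indG: "indep_vars (\<lambda>_. borel) (\<lambda>i. g i j) {..m}"
  proof -
    \<comment> \<open>The gains are indexed by pairs; restriction to the disjoint singletons {(i,
      j)} gives, for fixed j, an independent family indexed by i alone.\<close>
    have "indep_vars (\<lambda>i. PiM {(i, j)} (\<lambda>_. borel)) (\<lambda>i \<omega>. \<lambda>k\<in>{(i, j)}. (case k of (i, j) \<Rightarrow> g i j) \<omega>) {..m}"
      by (rule indep_vars_restrict[OF gains_indep]) (use j in \<open>auto simp: disjoint_family_on_def\<close>)
    from indep_vars_compose2[OF this, of "\<lambda>i v. v (i, j)" "\<lambda>_. borel"] show ?thesis
      by simp
  qed
  have factor: "0 \<le> 1 / (1 + \<beta> * (of_bool b * w i))" "1 / (1 + \<beta> * (of_bool b * w i)) \<le> 1" for b i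
    using \<beta> w[of i] by (auto simp: divide_le_eq)
  have factor_meas: "(\<lambda>\<omega>. 1 / (1 + \<beta> * (of_bool (I i \<omega>) * w i))) \<in> borel_measurable \<Omega>" if "i \<in> {1..m}" for i
  proof -
    have [measurable]: "I i \<in> measurable \<Omega> (count_space UNIV)"
      using activities_indep that by (auto simp: indep_vars_def)
    show ?thesis by measurable
  qed
  have f_meas: "(\<lambda>z. ?out (fst z) (snd z)) \<in> borel_measurable (activities_space \<Otimes>\<^sub>M gains_space)"
  proof -
    have [measurable]: "(\<lambda>z. snd z (i, j)) \<in> borel_measurable (activities_space \<Otimes>\<^sub>M gains_space)" for i
      by (rule measurable_compose[OF measurable_snd measurable_gain[OF j]])
    have [measurable]: "(\<lambda>z. of_bool (fst z i) :: real) \<in> borel_measurable (activities_space \<Otimes>\<^sub>M gains_space)"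
      if "i \<in> {1..m}" for i
      by (rule measurable_compose[OF measurable_fst measurable_of_bool_activity]) (use that in auto)
    show ?thesis by measurable
  qed
  have "expectation (\<lambda>\<omega>. ?out (activities \<omega>) (gains \<omega>))
      = expectation (\<lambda>\<omega>. expectation (\<lambda>\<omega>'. ?out (activities \<omega>) (gains \<omega>')))"
    using indep_set_freeze[OF measurable_activities measurable_gains indep_activities_gains f_meas, of 1]
    by simp
  also have "\<dots> = expectation (\<lambda>\<omega>. 1 - exp (- (\<beta> / SNR)) * (\<Prod>i=1..m. 1 / (1 + \<beta> * (of_bool (I i \<omega>) * w i))))"
  proof (rule Bochner_Integration.integral_cong[OF refl])
    fix \<omega>
    have "expectation (\<lambda>\<omega>'. of_bool (g 0 j \<omega>' / (inverse SNR + (\<Sum>i=1..m. (of_bool (I i \<omega>) * w i) * g i j \<omega>')) \<le> \<beta>))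
        = 1 - exp (- \<beta> * inverse SNR) * (\<Prod>i=1..m. 1 / (1 + \<beta> * (of_bool (I i \<omega>) * w i)))"
      by (rule rayleigh_outage[OF indG]) (use j gains_exponential w SNR \<beta> in auto)
    then show "expectation (\<lambda>\<omega>'. ?out (activities \<omega>) (gains \<omega>'))
        = 1 - exp (- (\<beta> / SNR)) * (\<Prod>i=1..m. 1 / (1 + \<beta> * (of_bool (I i \<omega>) * w i)))"
      unfolding val act by (simp add: divide_inverse)
  qed
  also have "\<dots> = 1 - exp (- (\<beta> / SNR)) * expectation (\<lambda>\<omega>. \<Prod>i=1..m. 1 / (1 + \<beta> * (of_bool (I i \<omega>) * w i)))"
  proof -
    have "integrable \<Omega> (\<lambda>\<omega>. \<Prod>i=1..m. 1 / (1 + \<beta> * (of_bool (I i \<omega>) * w i)))"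
      by (rule integrable_const_bound[where B = 1])
         (use factor in \<open>auto simp: abs_prod intro!: AE_I2 prod_le_1 borel_measurable_prod factor_meas\<close>)
    then show ?thesis by (simp add: prob_space)
  qed
  also have "expectation (\<lambda>\<omega>. \<Prod>i=1..m. 1 / (1 + \<beta> * (of_bool (I i \<omega>) * w i)))
      = (\<Prod>i=1..m. expectation (\<lambda>\<omega>. 1 / (1 + \<beta> * (of_bool (I i \<omega>) * w i))))"
  proof (rule indep_vars_lebesgue_integral)
    show "indep_vars (\<lambda>_. borel) (\<lambda>i \<omega>. 1 / (1 + \<beta> * (of_bool (I i \<omega>) * w i))) {1..m}"
      by (rule indep_vars_compose2[OF indep_vars_subset[OF activities_indep]]) auto
    show "integrable \<Omega> (\<lambda>\<omega>. 1 / (1 + \<beta> * (of_bool (I i \<omega>) * w i)))" if "i \<in> {1..m}" for i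
      by (rule integrable_const_bound[where B = 1])
         (use factor factor_meas that in \<open>auto intro!: AE_I2\<close>)
  qed simp
  also have "\<dots> = (\<Prod>i=1..m. 1 - p + p / (1 + \<beta> * w i))"
  proof (rule prod.cong[OF refl])
    fix i assume i: "i \<in> {1..m}"
    have "I i \<in> measurable \<Omega> (count_space UNIV)"
      using activities_indep i by (auto simp: indep_vars_def)
    then have "expectation (\<lambda>\<omega>. 1 / (1 + \<beta> * (of_bool (I i \<omega>) * w i)))
        = (LINT a|distr \<Omega> (count_space UNIV) (I i). 1 / (1 + \<beta> * (of_bool a * w i)))"
      by (subst integral_distr) auto
    also have "\<dots> = measure_pmf.expectation (bernoulli_pmf p) (\<lambda>a. 1 / (1 + \<beta> * (of_bool a * w i)))"
      using activities_bernoulli i by simp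
    also have "\<dots> = 1 - p + p / (1 + \<beta> * w i)"
      using p by simp
    finally show "expectation (\<lambda>\<omega>. 1 / (1 + \<beta> * (of_bool (I i \<omega>) * w i))) = 1 - p + p / (1 + \<beta> * w i)" .
  qed
  finally show ?thesis unfolding val act by (simp only: mult_ac)
qed

end

section \<open>The conditional outage probability and its moments\<close>

context rayleigh_network
begin

text \<open>The factor of one interferer in the conditional success probability, averaged over its
  activity. It uses \<open>r powr (- \<alpha>)\<close> exactly as \<open>sinr\<close> does, so that
  the conditional outage formula also holds, under the convention for
  \<open>0 powr (- \<alpha>)\<close>, when an interferer sits on a receiver.\<close>

definition success_factor :: "real \<Rightarrow> real" where
  "success_factor r = 1 - p + p / (1 + \<beta> * r powr (- \<alpha>))"

lemma success_factor_bounds: "0 \<le> success_factor r" "success_factor r \<le> 1"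
proof -
  have "0 < 1 + \<beta> * r powr (- \<alpha>)" using \<beta> by (intro add_pos_nonneg) auto
  moreover have "p / (1 + \<beta> * r powr (- \<alpha>)) \<le> p / 1"
    using \<beta> p by (intro divide_left_mono) (auto intro!: add_pos_nonneg)
  ultimately show "0 \<le> success_factor r" "success_factor r \<le> 1"
    using p by (auto simp: success_factor_def)
qed

lemma borel_measurable_success_factor [measurable]: "success_factor \<in> borel_measurable borel"
  unfolding success_factor_def[abs_def] by measurable

definition outage_of_distances :: "nat \<Rightarrow> nat \<times> (nat \<times> nat \<Rightarrow> real) \<Rightarrow> real" where
  "outage_of_distances j d = 1 - exp (- (\<beta> / SNR)) * (\<Prod>i=1..fst d. success_factor (snd d (i, j)))"

lemma borel_measurable_outage_of_distances:
  assumes j: "j \<in> {1, 2}"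
  shows "outage_of_distances j \<in> borel_measurable distances_space"
proof -
  have [measurable]: "(\<lambda>d. snd d (i, j)) \<in> borel_measurable distances_space" for i
    by (rule measurable_compose[OF measurable_snd measurable_component_singleton]) (use j in simp)
  have "(\<lambda>d. \<Prod>i=1..n. success_factor (snd d (i, j))) \<in> borel_measurable distances_space" for n
    by measurable
  then have "(\<lambda>d. \<Prod>i=1..fst d. success_factor (snd d (i, j))) \<in> borel_measurable distances_space"
    by (rule measurable_compose_countable) measurable
  then show ?thesis unfolding outage_of_distances_def[abs_def] by measurable
qed

text \<open>Through this map an event about the distances, on which one conditions, is an event
  about the positions, for which independence is available.\<close>

definition distances_of_positions :: "nat \<times> (nat \<Rightarrow> complex) \<Rightarrow> nat \<times> (nat \<times> nat \<Rightarrow> real)" where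
  "distances_of_positions z = (fst z, \<lambda>(i, j)\<in>UNIV \<times> {1, 2}.
     if i \<in> {1..fst z} then cmod (snd z i - receiver r0 \<theta> j) / r0 else 0)"

lemma distances_eq: "distances r0 \<theta> M X \<omega> = distances_of_positions (positions M X \<omega>)"
  by (auto simp: distances_def distances_of_positions_def positions_def rel_dist_def fun_eq_iff restrict_def)

lemma measurable_distances_of_positions [measurable]:
  "distances_of_positions \<in> measurable positions_space distances_space"
  unfolding distances_of_positions_def[abs_def]
proof (rule measurable_Pair[OF measurable_fst], rule measurable_restrict)
  fix k :: "nat \<times> nat"
  have [measurable]: "(\<lambda>z. snd z i) \<in> borel_measurable positions_space" for i
    by (rule measurable_compose[OF measurable_snd measurable_component_singleton]) simp
  show "(\<lambda>z. case k of (i, j) \<Rightarrow> if i \<in> {1..fst z} then cmod (snd z i - receiver r0 \<theta> j) / r0 else 0)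
      \<in> borel_measurable positions_space"
    by (cases k) simp
qed

lemma measurable_distances: "distances r0 \<theta> M X \<in> measurable \<Omega> distances_space"
  unfolding distances_eq[abs_def] by measurable

lemma sets_sigma_distances:
  "sets (sigma_distances \<Omega> r0 \<theta> M X) = {distances r0 \<theta> M X -` A \<inter> space \<Omega> | A. A \<in> sets distances_space}"
  unfolding sigma_distances_def
  by (rule sets_vimage_algebra2) (use measurable_space[OF measurable_distances] in auto)

lemma subalgebra_sigma_distances: "subalgebra \<Omega> (sigma_distances \<Omega> r0 \<theta> M X)"
  using measurable_sets[OF measurable_distances]
  by (auto simp: subalgebra_def sets_sigma_distances) (auto simp: sigma_distances_def)

text \<open>Separates the independent arguments of the outage event: the positions \<open>z\<close>,
  to be frozen, and the pair \<open>v\<close> of activities and gains, to be averaged.\<close>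

definition outage_indicator :: "nat \<Rightarrow> nat \<times> (nat \<Rightarrow> complex) \<Rightarrow> (nat \<Rightarrow> bool) \<times> (nat \<times> nat \<Rightarrow> real) \<Rightarrow> real" where
  "outage_indicator j z v = of_bool (snd v (0, j) / (inverse SNR +
     (\<Sum>i=1..fst z. of_bool (fst v i) * snd v (i, j) * (cmod (snd z i - receiver r0 \<theta> j) / r0) powr (- \<alpha>))) \<le> \<beta>)"

lemma borel_measurable_outage_indicator:
  assumes j: "j \<in> {1, 2}"
  shows "(\<lambda>y. outage_indicator j (fst y) (snd y))
    \<in> borel_measurable (positions_space \<Otimes>\<^sub>M (activities_space \<Otimes>\<^sub>M gains_space))"
    (is "_ \<in> borel_measurable ?S")
proof -
  have [measurable]: "(\<lambda>y. snd (fst y) i) \<in> borel_measurable ?S" for i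
    by (rule measurable_compose[OF measurable_fst
          measurable_compose[OF measurable_snd measurable_component_singleton]]) simp
  have [measurable]: "(\<lambda>y. snd (snd y) (i, j)) \<in> borel_measurable ?S" for i
    by (rule measurable_compose[OF measurable_snd measurable_compose[OF measurable_snd measurable_gain[OF j]]])
  have [measurable]: "(\<lambda>y. of_bool (fst (snd y) i) :: real) \<in> borel_measurable ?S" if "i \<in> {1..n}" for i n
    by (rule measurable_compose[OF measurable_snd
          measurable_compose[OF measurable_fst measurable_of_bool_activity]]) (use that in auto)
  have "(\<lambda>y. \<Sum>i=1..n. of_bool (fst (snd y) i) * snd (snd y) (i, j)
      * (cmod (snd (fst y) i - receiver r0 \<theta> j) / r0) powr (- \<alpha>)) \<in> borel_measurable ?S" for n
    by measurable
  then have [measurable]: "(\<lambda>y. \<Sum>i=1..fst (fst y). of_bool (fst (snd y) i) * snd (snd y) (i, j)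
      * (cmod (snd (fst y) i - receiver r0 \<theta> j) / r0) powr (- \<alpha>)) \<in> borel_measurable ?S"
    by (rule measurable_compose_countable) measurable
  show ?thesis unfolding outage_indicator_def by measurable
qed

lemma outage_indicator_eq:
  assumes j: "j \<in> {1, 2}"
  shows "outage_indicator j (positions M X \<omega>') (activities \<omega>, gains \<omega>) =
    of_bool (g 0 j \<omega> / (inverse SNR +
      (\<Sum>i=1..M \<omega>'. of_bool (I i \<omega>) * g i j \<omega> * rel_dist r0 \<theta> X i j \<omega>' powr (- \<alpha>))) \<le> \<beta>)"
proof -
  have "gains \<omega> (i, j) = g i j \<omega>" for i using j by (auto simp: gains_def)
  then have "(\<Sum>i=1..fst (positions M X \<omega>'). of_bool (fst (activities \<omega>, gains \<omega>) i) * snd (activities \<omega>, gains \<omega>) (i, j)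
      * (cmod (snd (positions M X \<omega>') i - receiver r0 \<theta> j) / r0) powr (- \<alpha>))
    = (\<Sum>i=1..M \<omega>'. of_bool (I i \<omega>) * g i j \<omega> * rel_dist r0 \<theta> X i j \<omega>' powr (- \<alpha>))"
    by (intro sum.cong) (auto simp: positions_def activities_def rel_dist_def)
  then show ?thesis using j by (simp only: outage_indicator_def) (auto simp: gains_def)
qed

text \<open>At frozen positions the average over activities and gains depends on them only through
  the distances; so conditioning on the coarser data gives the same value.\<close>

lemma expectation_outage_indicator:
  assumes j: "j \<in> {1, 2}"
  shows "expectation (\<lambda>\<omega>. outage_indicator j (positions M X \<omega>') (activities \<omega>, gains \<omega>))
    = outage_of_distances j (distances r0 \<theta> M X \<omega>')"
proof -
  have "snd (distances r0 \<theta> M X \<omega>') (i, j) = rel_dist r0 \<theta> X i j \<omega>'" if "i \<in> {1..M \<omega>'}" for i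
    using that j by (auto simp: distances_def)
  then have "(\<Prod>i=1..M \<omega>'. success_factor (snd (distances r0 \<theta> M X \<omega>') (i, j)))
      = (\<Prod>i=1..M \<omega>'. 1 - p + p / (1 + \<beta> * rel_dist r0 \<theta> X i j \<omega>' powr (- \<alpha>)))"
    by (intro prod.cong) (auto simp: success_factor_def)
  then show ?thesis
    unfolding outage_indicator_eq[OF j] outage_of_distances_def
    by (subst conditional_outage[OF j]) (auto simp: distances_def)
qed

text \<open>Conditional expectations are characterized by their integrals over the events of the
  conditioning sigma-algebra. Such an event is given by a set \<open>B\<close> of distances, hence
  fixed by the positions; freezing these replaces the outage indicator by its mean, which is
  measurable for the distances.\<close>

lemma outage_prob_AE:
  assumes j: "j \<in> {1, 2}"
  shows "AE \<omega> in \<Omega>. outage_prob \<Omega> \<alpha> \<beta> SNR r0 \<theta> M X I g j \<omega>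
    = outage_of_distances j (distances r0 \<theta> M X \<omega>)"
proof -
  let ?F = "sigma_distances \<Omega> r0 \<theta> M X"
  let ?V = "\<lambda>\<omega>. (activities \<omega>, gains \<omega>)"
  let ?ind = "indicator {\<omega> \<in> space \<Omega>. sinr \<alpha> SNR r0 \<theta> M X I g j \<omega> \<le> \<beta>} :: 'w \<Rightarrow> real"
  interpret finite_measure_subalgebra \<Omega> ?F
    by standard (rule subalgebra_sigma_distances)
  have V: "?V \<in> measurable \<Omega> (activities_space \<Otimes>\<^sub>M gains_space)" by measurable
  have dist_F: "distances r0 \<theta> M X \<in> measurable ?F distances_space"
    unfolding sigma_distances_def
    by (rule measurable_vimage_algebra1) (use measurable_space[OF measurable_distances] in auto)
  have R_F: "(\<lambda>\<omega>. outage_of_distances j (distances r0 \<theta> M X \<omega>)) \<in> borel_measurable ?F"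
    by (rule measurable_compose[OF dist_F borel_measurable_outage_of_distances[OF j]])
  have R: "(\<lambda>\<omega>. outage_of_distances j (distances r0 \<theta> M X \<omega>)) \<in> borel_measurable \<Omega>"
    by (rule measurable_compose[OF measurable_distances borel_measurable_outage_of_distances[OF j]])
  have ind_eq: "?ind \<omega> = outage_indicator j (positions M X \<omega>) (?V \<omega>)" if "\<omega> \<in> space \<Omega>" for \<omega>
    using that unfolding outage_indicator_eq[OF j] by (simp add: indicator_def sinr_def)
  have "(\<lambda>\<omega>. outage_indicator j (positions M X \<omega>) (?V \<omega>)) \<in> borel_measurable \<Omega>"
    using measurable_compose[OF measurable_Pair[OF measurable_positions V] borel_measurable_outage_indicator[OF j]]
    by simp
  then have ind_meas: "?ind \<in> borel_measurable \<Omega>"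
    by (subst measurable_cong[OF ind_eq]) auto
  have R_bound: "\<bar>outage_of_distances j d\<bar> \<le> 1" for d
  proof -
    have "0 \<le> (\<Prod>i=1..fst d. success_factor (snd d (i, j)))" "(\<Prod>i=1..fst d. success_factor (snd d (i, j))) \<le> 1"
      using success_factor_bounds by (auto intro!: prod_nonneg prod_le_1)
    moreover have "exp (- (\<beta> / SNR)) \<le> 1" using \<beta> SNR by simp
    ultimately have "exp (- (\<beta> / SNR)) * (\<Prod>i=1..fst d. success_factor (snd d (i, j))) \<le> 1"
      by (intro mult_le_one) auto
    moreover have "0 \<le> exp (- (\<beta> / SNR)) * (\<Prod>i=1..fst d. success_factor (snd d (i, j)))"
      using \<open>0 \<le> (\<Prod>i=1..fst d. _ i)\<close> by simp
    ultimately show ?thesis by (simp add: outage_of_distances_def)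
  qed
  have "AE \<omega> in \<Omega>. real_cond_exp \<Omega> ?F ?ind \<omega> = outage_of_distances j (distances r0 \<theta> M X \<omega>)"
  proof (rule real_cond_exp_charact)
    fix A assume "A \<in> sets ?F"
    then obtain B where B: "B \<in> sets distances_space" and A: "A = distances r0 \<theta> M X -` B \<inter> space \<Omega>"
      unfolding sets_sigma_distances by blast
    let ?f = "\<lambda>y. indicator B (distances_of_positions (fst y)) * outage_indicator j (fst y) (snd y)"
    have f: "?f \<in> borel_measurable (positions_space \<Otimes>\<^sub>M (activities_space \<Otimes>\<^sub>M gains_space))"
      using B borel_measurable_outage_indicator[OF j] by measurable
    have "(\<integral>\<omega>\<in>A. ?ind \<omega> \<partial>\<Omega>) = expectation (\<lambda>\<omega>. ?f (positions M X \<omega>, ?V \<omega>))"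
      unfolding set_lebesgue_integral_def
    proof (rule Bochner_Integration.integral_cong[OF refl])
      fix \<omega> assume "\<omega> \<in> space \<Omega>"
      from ind_eq[OF this] this show "indicator A \<omega> *\<^sub>R ?ind \<omega> = ?f (positions M X \<omega>, ?V \<omega>)"
        by (simp add: A distances_eq indicator_def)
    qed
    also have "\<dots> = expectation (\<lambda>\<omega>. expectation (\<lambda>\<omega>'. ?f (positions M X \<omega>, ?V \<omega>')))"
      by (rule indep_set_freeze[OF measurable_positions V indep_positions_rest f, of 1])
         (auto simp: indicator_def outage_indicator_def)
    also have "\<dots> = expectation (\<lambda>\<omega>. indicator B (distances r0 \<theta> M X \<omega>) *
        outage_of_distances j (distances r0 \<theta> M X \<omega>))"
      using expectation_outage_indicator[OF j] by (simp add: distances_eq)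
    also have "\<dots> = (\<integral>\<omega>\<in>A. outage_of_distances j (distances r0 \<theta> M X \<omega>) \<partial>\<Omega>)"
      unfolding set_lebesgue_integral_def
      by (rule Bochner_Integration.integral_cong) (auto simp: A indicator_def)
    finally show "(\<integral>\<omega>\<in>A. ?ind \<omega> \<partial>\<Omega>) = (\<integral>\<omega>\<in>A. outage_of_distances j (distances r0 \<theta> M X \<omega>) \<partial>\<Omega>)" .
  next
    show "integrable \<Omega> ?ind"
      by (rule integrable_const_bound[where B = 1]) (use ind_meas in \<open>auto simp: indicator_def\<close>)
    show "integrable \<Omega> (\<lambda>\<omega>. outage_of_distances j (distances r0 \<theta> M X \<omega>))"
      by (rule integrable_const_bound[where B = 1]) (use R R_bound in auto)
  qed (rule R_F)
  then show ?thesis by (simp add: outage_prob_def)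
qed

text \<open>A product over the points of the process instead of the enumeration \<open>X i\<close>:
  the form to which the generating functional applies.\<close>

definition success_product :: "nat \<Rightarrow> 'w \<Rightarrow> real" where
  "success_product j \<omega> = (\<Prod>x\<in>\<Phi> \<omega> \<inter> network_region rout. success_factor (cmod (x - receiver r0 \<theta> j) / r0))"

lemma region: "network_region rout \<in> sets borel" "bounded (network_region rout)"
  by (auto simp: network_region_def)

lemma measure_region: "measure lborel (network_region rout) = region_area rout"
  using r0 by (simp add: network_region_def region_area_def content_cball unit_ball_vol_2)

lemma outage_of_distances_eq:
  assumes \<omega>: "\<omega> \<in> space \<Omega>" and j: "j \<in> {1, 2}"
  shows "outage_of_distances j (distances r0 \<theta> M X \<omega>) = 1 - exp (- (\<beta> / SNR)) * success_product j \<omega>"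
proof -
  have bij: "bij_betw (\<lambda>i. X i \<omega>) {1..M \<omega>} (\<Phi> \<omega> \<inter> network_region rout)"
    using interferers \<omega> by blast
  have "(\<Prod>i=1..M \<omega>. success_factor (snd (distances r0 \<theta> M X \<omega>) (i, j)))
      = (\<Prod>i=1..M \<omega>. success_factor (cmod (X i \<omega> - receiver r0 \<theta> j) / r0))"
    using j by (intro prod.cong) (auto simp: distances_def rel_dist_def)
  also have "\<dots> = success_product j \<omega>"
    unfolding success_product_def by (rule prod.reindex_bij_betw[OF bij])
  finally show ?thesis by (simp add: outage_of_distances_def distances_def)
qed

text \<open>At \<open>r = 0\<close> the left side is \<open>1\<close> and the right side \<open>1 - p\<close>, because \<open>0 powr (- \<alpha>) = 0\<close>.\<close>

lemma success_factor_eq_loss: "r > 0 \<Longrightarrow> success_factor r = 1 - p + p * loss \<alpha> \<beta> r"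
  using \<beta> by (simp add: success_factor_def loss_def powr_minus field_simps add_pos_pos)

lemma success_factor_AE:
  "AE z in lborel. success_factor (cmod (z - receiver r0 \<theta> j) / r0)
    = 1 - p + p * loss \<alpha> \<beta> (cmod (z - receiver r0 \<theta> j) / r0)"
  using AE_lborel_singleton[of "receiver r0 \<theta> j"]
  by eventually_elim (use r0 in \<open>simp add: success_factor_eq_loss\<close>)

section \<open>First and second moments of the success products\<close>

lemma set_integrable_region:
  fixes h :: "complex \<Rightarrow> real"
  assumes [measurable]: "h \<in> borel_measurable borel" and "\<And>z. \<bar>h z\<bar> \<le> 1"
  shows "set_integrable lborel (network_region rout) h"
  unfolding set_integrable_def
proof (rule Bochner_Integration.integrable_bound)
  show "integrable lborel (indicator (network_region rout) :: complex \<Rightarrow> real)"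
    using emeasure_bounded_finite[OF region(2)] region by (intro integrable_real_indicator) auto
  show "(\<lambda>z. indicator (network_region rout) z *\<^sub>R h z) \<in> borel_measurable lborel"
    using region by measurable
  show "AE z in lborel. norm (indicator (network_region rout) z *\<^sub>R h z)
      \<le> norm (indicator (network_region rout) z :: real)"
    using assms(2) by (intro AE_I2) (auto simp: indicator_def)
qed

lemma set_integral_region_const: "(LINT z:network_region rout|lborel. c) = c * region_area rout" for c :: real
  using region by (simp add: set_lebesgue_integral_def measure_region)

abbreviation region_loss :: "nat \<Rightarrow> complex \<Rightarrow> real" where
  "region_loss j z \<equiv> loss \<alpha> \<beta> (cmod (z - receiver r0 \<theta> j) / r0)"

lemma region_loss_abs: "\<bar>region_loss j z\<bar> \<le> 1"
  using loss_bounds[OF \<beta>, of \<alpha> "cmod (z - receiver r0 \<theta> j) / r0"] by simp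

text \<open>Despite its name this is the integral of the loss over the disk, not divided by the
  area; it is common to both receivers.\<close>

definition mean_loss :: real where
  "mean_loss = 2 * r0\<^sup>2 * (pi / \<beta> * Psi \<alpha> \<beta> ((rout - r0) / r0) + calZ \<alpha> \<beta> 1 rout r0)"

lemma region_loss_mean: "(LINT z:network_region rout|lborel. region_loss j z) = mean_loss"
  unfolding mean_loss_def by (rule region_integral_loss[OF \<beta> r0])

text \<open>The generating functional is applied to the success factor, which is almost everywhere 1
  - p + p * loss; its complement p * (1 - loss) integrates to p times area minus
  \<open>mean_loss\<close>.\<close>

lemma success_product_meas [measurable]: "success_product j \<in> borel_measurable \<Omega>"
  and expectation_success_product:
    "expectation (success_product j) = exp (- rate * p * (region_area rout - mean_loss))"
proof -
  let ?h = "\<lambda>z. success_factor (cmod (z - receiver r0 \<theta> j) / r0)"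
  have h: "?h \<in> borel_measurable borel" by measurable
  note pgf = poisson_generating_functional[OF poisson less_imp_le[OF rate] region h success_factor_bounds]
  show "success_product j \<in> borel_measurable \<Omega>"
    using pgf(1) by (simp add: success_product_def[abs_def])
  have "(LINT z:network_region rout|lborel. 1 - ?h z)
      = (LINT z:network_region rout|lborel. p - p * region_loss j z)"
    unfolding set_lebesgue_integral_def
    by (rule integral_cong_AE) (use success_factor_AE[of j] region in \<open>auto elim: eventually_mono\<close>)
  also have "\<dots> = (LINT z:network_region rout|lborel. p) - (LINT z:network_region rout|lborel. p * region_loss j z)"
    by (intro set_integral_diff set_integrable_region)
       (use p region_loss_abs in \<open>auto simp: abs_mult intro!: mult_le_one\<close>)
  also have "\<dots> = p * (region_area rout - mean_loss)"
    by (simp add: set_integral_region_const region_loss_mean right_diff_distrib)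
  finally show "expectation (success_product j) = exp (- rate * p * (region_area rout - mean_loss))"
    using pgf(2) by (simp add: success_product_def[abs_def] mult.assoc)
qed

text \<open>Both products run over the same points, so together they form one product over the
  process, with factor (1 - p + p l_a) (1 - p + p l_b). The two linear terms integrate to the same
  \<open>mean_loss\<close>; only the integral \<open>c\<close> of l_a l_b distinguishes the second
  moment (a = b) from the mixed one.\<close>

lemma expectation_success_product_pair:
  assumes c: "(LINT z:network_region rout|lborel. region_loss a z * region_loss b z) = c"
  shows "expectation (\<lambda>\<omega>. success_product a \<omega> * success_product b \<omega>)
    = exp (- rate * (region_area rout - ((1 - p)\<^sup>2 * region_area rout + 2 * p * (1 - p) * mean_loss + p\<^sup>2 * c)))"
proof -
  let ?q = "\<lambda>j z. success_factor (cmod (z - receiver r0 \<theta> j) / r0)"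
  let ?h = "\<lambda>z. ?q a z * ?q b z"
  have h: "?h \<in> borel_measurable borel" by measurable
  have h01: "0 \<le> ?h z" "?h z \<le> 1" for z
    using success_factor_bounds by (auto intro!: mult_le_one)
  note pgf = poisson_generating_functional[OF poisson less_imp_le[OF rate] region h h01]
  let ?l = "\<lambda>z. p * (1 - p) * region_loss a z + p * (1 - p) * region_loss b z"
  let ?m = "\<lambda>z. p\<^sup>2 * (region_loss a z * region_loss b z)"
  have coeff: "\<bar>p * (1 - p)\<bar> \<le> 1" "\<bar>p\<^sup>2\<bar> \<le> 1" "\<bar>1 - (1 - p)\<^sup>2\<bar> \<le> 1"
    using p by (auto simp: abs_mult power_le_one intro!: mult_le_one)
  have term1: "set_integrable lborel (network_region rout) (\<lambda>z. p * (1 - p) * region_loss j z)" for j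
      proof (rule set_integrable_region)
    show "\<bar>p * (1 - p) * region_loss j z\<bar> \<le> 1" for z
      unfolding abs_mult[of "p * (1 - p)"] by (intro mult_le_one coeff region_loss_abs) simp
  qed measurable
  have term2: "set_integrable lborel (network_region rout) ?m"
  proof (rule set_integrable_region)
    show "\<bar>?m z\<bar> \<le> 1" for z
      unfolding abs_mult[of "p\<^sup>2"] abs_mult[of "region_loss a _"]
      by (intro mult_le_one coeff region_loss_abs) auto
  qed measurable
  have term0: "set_integrable lborel (network_region rout) (\<lambda>z. 1 - (1 - p)\<^sup>2)"
    using coeff(3) by (intro set_integrable_region) auto
  have "(LINT z:network_region rout|lborel. 1 - ?h z)
      = (LINT z:network_region rout|lborel. (1 - (1 - p)\<^sup>2) - (?l z + ?m z))"
    unfolding set_lebesgue_integral_def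
  proof (rule integral_cong_AE)
    show "AE z in lborel. indicator (network_region rout) z *\<^sub>R (1 - ?h z)
        = indicator (network_region rout) z *\<^sub>R ((1 - (1 - p)\<^sup>2) - (?l z + ?m z))"
      using success_factor_AE[of a] success_factor_AE[of b]
    proof eventually_elim
      case (elim z)
      show ?case unfolding elim by (simp add: power2_eq_square algebra_simps)
    qed
  qed (use region in auto)
  also have "\<dots> = (1 - (1 - p)\<^sup>2) * region_area rout - (2 * p * (1 - p) * mean_loss + p\<^sup>2 * c)"
    using term0 term1 term2
    by (simp add: set_integral_diff set_integral_add set_integral_region_const region_loss_mean c)
  also have "\<dots> = region_area rout
      - ((1 - p)\<^sup>2 * region_area rout + 2 * p * (1 - p) * mean_loss + p\<^sup>2 * c)"
    by (simp add: algebra_simps)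
  finally have integral: "(LINT z:network_region rout|lborel. 1 - ?h z) = region_area rout
      - ((1 - p)\<^sup>2 * region_area rout + 2 * p * (1 - p) * mean_loss + p\<^sup>2 * c)" .
  show ?thesis
    using pgf(2) unfolding integral by (simp add: success_product_def prod.distrib)
qed

lemma success_product_bounds: "0 \<le> success_product j \<omega>" "success_product j \<omega> \<le> 1"
  using success_factor_bounds by (auto simp: success_product_def intro!: prod_nonneg prod_le_1)

lemma integrable_success_product:
  "integrable \<Omega> (success_product a)" "integrable \<Omega> (\<lambda>\<omega>. success_product a \<omega> * success_product b \<omega>)"
proof -
  show "integrable \<Omega> (success_product a)"
    by (rule integrable_const_bound[where B = 1]) (use success_product_bounds in auto)
  show "integrable \<Omega> (\<lambda>\<omega>. success_product a \<omega> * success_product b \<omega>)"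
    by (rule integrable_const_bound[where B = 1])
       (use success_product_bounds in \<open>auto simp: abs_mult intro!: AE_I2 mult_le_one\<close>)
qed

section \<open>Moments of the conditional outage probability\<close>

abbreviation \<epsilon> :: "nat \<Rightarrow> 'w \<Rightarrow> real" where
  "\<epsilon> \<equiv> outage_prob \<Omega> \<alpha> \<beta> SNR r0 \<theta> M X I g"

lemma borel_measurable_outage_prob [measurable]: "\<epsilon> j \<in> borel_measurable \<Omega>"
  unfolding outage_prob_def by measurable

lemma outage_prob_AE_success:
  assumes "j \<in> {1, 2}"
  shows "AE \<omega> in \<Omega>. \<epsilon> j \<omega> = 1 - exp (- (\<beta> / SNR)) * success_product j \<omega>"
  using outage_prob_AE[OF assms] AE_space
  by eventually_elim (simp add: outage_of_distances_eq[OF _ assms])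

lemma expectation_outage:
  assumes j: "j \<in> {1, 2}"
  shows "expectation (\<epsilon> j) = 1 - exp (- (\<beta> / SNR) - rate * p * (region_area rout - mean_loss))"
proof -
  have "expectation (\<epsilon> j) = expectation (\<lambda>\<omega>. 1 - exp (- (\<beta> / SNR)) * success_product j \<omega>)"
    by (rule integral_cong_AE) (use outage_prob_AE_success[OF j] in auto)
  also have "\<dots> = 1 - exp (- (\<beta> / SNR)) * expectation (success_product j)"
    using integrable_success_product(1) by (simp add: prob_space)
  finally show ?thesis
    by (simp add: expectation_success_product exp_add[symmetric])
qed

text \<open>Expanding (1 - e s_a) (1 - e s_b), with e = exp (- (\<beta> / SNR)) and s_a, s_b the
  success products, leaves two linear terms of equal mean. They combine to twice the mean outage at
  either receiver \<open>j\<close> minus 1, and e^2 times the mean of s_a s_b remains.\<close>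

lemma expectation_outage_pair:
  assumes a: "a \<in> {1, 2}" and b: "b \<in> {1, 2}" and j: "j \<in> {1, 2}"
    and c: "(LINT z:network_region rout|lborel. region_loss a z * region_loss b z) = c"
  shows "expectation (\<lambda>\<omega>. \<epsilon> a \<omega> * \<epsilon> b \<omega>) = 2 * expectation (\<epsilon> j) - 1
    + exp (- (2 * \<beta> / SNR) - rate * (region_area rout
        - ((1 - p)\<^sup>2 * region_area rout + 2 * p * (1 - p) * mean_loss + p\<^sup>2 * c)))"
proof -
  let ?e = "exp (- (\<beta> / SNR))"
  have "expectation (\<lambda>\<omega>. \<epsilon> a \<omega> * \<epsilon> b \<omega>)
      = expectation (\<lambda>\<omega>. 1 - ?e * success_product a \<omega> - ?e * success_product b \<omega>
          + ?e\<^sup>2 * (success_product a \<omega> * success_product b \<omega>))"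
  proof (rule integral_cong_AE)
    show "AE \<omega> in \<Omega>. \<epsilon> a \<omega> * \<epsilon> b \<omega> = 1 - ?e * success_product a \<omega> - ?e * success_product b \<omega>
          + ?e\<^sup>2 * (success_product a \<omega> * success_product b \<omega>)"
      using outage_prob_AE_success[OF a] outage_prob_AE_success[OF b]
      by eventually_elim (simp add: power2_eq_square left_diff_distrib right_diff_distrib mult_ac)
  qed measurable
  also have "\<dots> = 1 - ?e * expectation (success_product a) - ?e * expectation (success_product b)
      + ?e\<^sup>2 * expectation (\<lambda>\<omega>. success_product a \<omega> * success_product b \<omega>)"
    using integrable_success_product by (simp add: prob_space)
  also have "\<dots> = 2 * (1 - ?e * expectation (success_product j)) - 1
      + ?e\<^sup>2 * expectation (\<lambda>\<omega>. success_product a \<omega> * success_product b \<omega>)"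
    by (simp add: expectation_success_product)
  also have "1 - ?e * expectation (success_product j) = expectation (\<epsilon> j)"
    by (simp add: expectation_outage[OF j] expectation_success_product exp_add[symmetric])
  also have "?e\<^sup>2 = exp (- (2 * \<beta> / SNR))"
    by (simp add: power2_eq_square exp_add[symmetric])
  finally show ?thesis
    by (simp add: expectation_success_product_pair[OF c] exp_add[symmetric])
qed

end

theorem mainTheorem4:
  fixes \<Omega> :: "'w measure"
    and \<Phi> :: "'w \<Rightarrow> complex set"
    and M :: "'w \<Rightarrow> nat"
    and X :: "nat \<Rightarrow> 'w \<Rightarrow> complex"
    and I :: "nat \<Rightarrow> 'w \<Rightarrow> bool"
    and g :: "nat \<Rightarrow> nat \<Rightarrow> 'w \<Rightarrow> real"
    and \<alpha> \<beta> SNR rate p rout r0 \<theta> :: real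
  assumes "prob_space \<Omega>"
    and "\<alpha> > 0" and "\<beta> > 0" and "SNR > 0" and "rate > 0"
    and "0 \<le> p" and "p \<le> 1"
    and "0 < r0" and "r0 \<le> rout"
    and poisson: "homogeneous_poisson_process \<Omega> rate \<Phi>"
    and interferers: "\<forall>\<omega>\<in>space \<Omega>. bij_betw (\<lambda>i. X i \<omega>) {1..M \<omega>} (\<Phi> \<omega> \<inter> network_region rout)"
    and gains_indep: "prob_space.indep_vars \<Omega> (\<lambda>_. borel) (\<lambda>(i, j). g i j) (UNIV \<times> {1, 2})"
    and gains_exponential:
      "\<forall>i. \<forall>j\<in>{1, 2}. distributed \<Omega> lborel (g i j) (exponential_density 1)"
    and activities_indep: "prob_space.indep_vars \<Omega> (\<lambda>_. count_space UNIV) I {1..}"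
    and activities_bernoulli:
      "\<forall>i\<ge>1. distr \<Omega> (count_space UNIV) (I i) = measure_pmf (bernoulli_pmf p)"
    and mutually_indep:
      "prob_space.indep_sets \<Omega>
         (\<lambda>k. [sets (sigma_gains \<Omega> g), sets (sigma_activities \<Omega> I), sets (sigma_positions \<Omega> M X)] ! k)
         {0, 1, 2}"
  shows
    "let \<epsilon> = outage_prob \<Omega> \<alpha> \<beta> SNR r0 \<theta> M X I g in
     \<forall>i\<in>{1, 2}.
       (LINT \<omega>|\<Omega>. \<epsilon> i \<omega>) =
         1 - exp (- (\<beta> / SNR) - 2 * rate * p *
               (region_area rout / 2
                - pi * r0\<^sup>2 / \<beta> * Psi \<alpha> \<beta> ((rout - r0) / r0)
                - r0\<^sup>2 * calZ \<alpha> \<beta> 1 rout r0)) \<and>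
       (LINT \<omega>|\<Omega>. (\<epsilon> i \<omega>)\<^sup>2) =
         2 * (LINT \<omega>|\<Omega>. \<epsilon> i \<omega>) - 1
         + exp (- (2 * \<beta> / SNR) - rate * region_area rout * (1 - calS \<alpha> \<beta> p rout r0)) \<and>
       (LINT \<omega>|\<Omega>. \<epsilon> 1 \<omega> * \<epsilon> 2 \<omega>) =
         2 * (LINT \<omega>|\<Omega>. \<epsilon> i \<omega>) - 1
         + exp (- (2 * \<beta> / SNR) - rate * region_area rout * (1 - calW \<alpha> \<beta> p rout r0 \<theta>))"
proof -
  interpret prob_space \<Omega> by fact
  interpret rayleigh_network \<Omega> \<Phi> M X I g \<alpha> \<beta> SNR rate p rout r0 \<theta>
    by standard fact+
  have area: "region_area rout > 0"
    using \<open>0 < r0\<close> \<open>r0 \<le> rout\<close> by (simp add: region_area_def)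
  \<comment> \<open>The area \<open>A\<close> is factored out. \<open>mean_loss\<close> has the form
    2 r0^2 K, and the binomial coefficient 2 p (1 - p) turns it into the 4 r0^2 / A of
    \<open>calS\<close>; \<open>L\<close> is the bracket with \<open>calG\<close> and the second
    \<open>calZ\<close>.\<close>
  have S_identity: "A - ((1 - p)\<^sup>2 * A + 2 * p * (1 - p) * (2 * r0\<^sup>2 * K) + p\<^sup>2 * (2 * r0\<^sup>2 * L))
      = A * (1 - ((1 - p)\<^sup>2 + 4 * r0\<^sup>2 / A * (1 - p) * p * K + 2 * r0\<^sup>2 * p\<^sup>2 / A * L))"
    if "A \<noteq> 0" for A K L :: real
    using that by (simp add: field_simps)
  \<comment> \<open>Here the last integral is already a multiple of the area, so \<open>calX\<close>
    appears without a factor 1 / A.\<close>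
  have W_identity: "A - ((1 - p)\<^sup>2 * A + 2 * p * (1 - p) * (2 * r0\<^sup>2 * K) + p\<^sup>2 * (A * L))
      = A * (1 - ((1 - p)\<^sup>2 + p\<^sup>2 * L + 4 * r0\<^sup>2 / A * (1 - p) * p * K))"
    if "A \<noteq> 0" for A K L :: real
    using that by (simp add: field_simps)
  show ?thesis
    unfolding Let_def
  proof (intro ballI conjI)
    fix i :: nat assume i: "i \<in> {1, 2}"
    show "(LINT \<omega>|\<Omega>. \<epsilon> i \<omega>) = 1 - exp (- (\<beta> / SNR) - 2 * rate * p *
        (region_area rout / 2 - pi * r0\<^sup>2 / \<beta> * Psi \<alpha> \<beta> ((rout - r0) / r0)
          - r0\<^sup>2 * calZ \<alpha> \<beta> 1 rout r0))"
      \<comment> \<open>\<open>mean_loss\<close> is twice the sum of the two subtracted terms; this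
        2 is the one in \<open>2 * rate * p\<close>.\<close>
      unfolding expectation_outage[OF i] mean_loss_def by (simp add: algebra_simps)
    have "region_area rout - ((1 - p)\<^sup>2 * region_area rout + 2 * p * (1 - p) * mean_loss
          + p\<^sup>2 * (2 * r0\<^sup>2 * (pi * calG \<alpha> \<beta> ((rout - r0) / r0) + calZ \<alpha> \<beta> 2 rout r0)))
        = region_area rout * (1 - calS \<alpha> \<beta> p rout r0)"
      unfolding calS_def mean_loss_def using area by (intro S_identity) simp
    then show "(LINT \<omega>|\<Omega>. (\<epsilon> i \<omega>)\<^sup>2) = 2 * (LINT \<omega>|\<Omega>. \<epsilon> i \<omega>) - 1
        + exp (- (2 * \<beta> / SNR) - rate * region_area rout * (1 - calS \<alpha> \<beta> p rout r0))"
      using expectation_outage_pair[OF i i i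
          region_integral_loss_sq[OF \<beta> r0, of \<alpha> \<theta> i, unfolded power2_eq_square[of "loss _ _ _"]]]
      by (simp add: power2_eq_square[of "\<epsilon> _ _"] mult.assoc)
    have "region_area rout - ((1 - p)\<^sup>2 * region_area rout + 2 * p * (1 - p) * mean_loss
          + p\<^sup>2 * (region_area rout * calX \<alpha> \<beta> rout r0 \<theta>))
        = region_area rout * (1 - calW \<alpha> \<beta> p rout r0 \<theta>)"
      unfolding calW_def mean_loss_def using area by (intro W_identity) simp
    then show "(LINT \<omega>|\<Omega>. \<epsilon> 1 \<omega> * \<epsilon> 2 \<omega>) = 2 * (LINT \<omega>|\<Omega>. \<epsilon> i \<omega>) - 1
        + exp (- (2 * \<beta> / SNR) - rate * region_area rout * (1 - calW \<alpha> \<beta> p rout r0 \<theta>))"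
      \<comment> \<open>The mixed case a = 1, b = 2; \<open>i\<close> selects which of the two equal
        means is quoted.\<close>
      using expectation_outage_pair[OF _ _ i region_integral_loss_product[OF \<beta> r0, of \<alpha> \<theta>]]
      by (simp add: mult.assoc)
  qed
qed

end
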